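(* Let $H\in(1/3,1/2)$ and $\alpha\in(1/3,H)$. Let $(b^H,w)$ be the $\mathbb{R}^{d+e}$-valued mixed fractional Brownian motion with rough path lift $\Lambda=(\Lambda^1,\Lambda^2)\in\Omega_\alpha(\mathbb{R}^{d+e})$, and let $h=(u,v)\in\mathcal{H}=\mathcal{H}^{H,d}\oplus\mathcal{H}^{1/2,e}$. Then, almost surely, the translated path $(b^H+u,w+v)$ can be lifted to a rough path $T^h(\Lambda)=(T^{h,1}(\Lambda),T^{h,2}(\Lambda))\in\Omega_\alpha(\mathbb{R}^{d+e})$ defined by $$T^{h,1}_{s,t}(\Lambda)=(b^H+u,w+v)_{s,t},$$ $$T^{h,2}_{s,t}(\Lambda)=\Lambda^2_{s,t}+\begin{pmatrix}I[b^H,u]+I[u,b^H]+U^2& I[b^H,v]+I[u,w]+I[u,v]\\ I[w,u]+I[v,b^H]+I[v,u]& I[w,v]+I[v,w]+V^2\end{pmatrix}_{s,t},$$ where all the integrals in the second matrix are well defined in the variation (Young) sense.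
   Context: All processes are on $[0,T]$; $x_{s,t}=x_t-x_s$ for a path $x$. $b^H$ is a $d$-dimensional fractional Brownian motion of Hurst parameter $H$ (independent components with covariance $\frac12(t^{2H}+s^{2H}-|t-s|^{2H})$), $w$ an independent $e$-dimensional standard Brownian motion; $\mathcal{H}^{H,d}$, $\mathcal{H}^{1/2,e}$ are their Cameron–Martin (reproducing kernel Hilbert) spaces. $\Omega_\alpha(\mathcal{V})$, for $1/3<\alpha<1/2$, is the set of continuous $\Xi=(\Xi^1,\Xi^2)$, $(s,t)\mapsto(\Xi^1_{s,t},\Xi^2_{s,t})\in\mathcal{V}\oplus\mathcal{V}^{\otimes2}$, $0\le s\le t\le T$, with $\Xi^1_{s,t}=\Xi^1_{s,r}+\Xi^1_{r,t}$, $\Xi^2_{s,t}=\Xi^2_{s,r}+\Xi^2_{r,t}+\Xi^1_{s,r}\otimes\Xi^1_{r,t}$ for $s\le r\le t$, and $\sup_{s<t}|\Xi^1_{s,t}|/(t-s)^\alpha<\infty$, $\sup_{s<t}|\Xi^2_{s,t}|/(t-s)^{2\alpha}<\infty$. The lift $\Lambda$ is $\Lambda^1_{s,t}=(b^H_{s,t},w_{s,t})$, $$\Lambda^2_{s,t}=\begin{pmatrix}B^{H,2}_{s,t}&\int_s^tb^H_{s,r}\otimes d^{\mathrm I}w_r\\ w_{s,t}\otimes b^H_{s,t}-\int_s^td^{\mathrm I}w_r\otimes b^H_{s,r}&W^2_{s,t}\end{pmatrix},$$ where $d^{\mathrm I}w$ is Itô integration, $(b^H_{\cdot,\cdot},B^{H,2})$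 is the canonical geometric rough path lift of $b^H$, and $W^2_{s,t}=\int_s^tw_{s,r}\otimes d^{\mathrm I}w_r$. It is known that $\Lambda\in\Omega_\alpha(\mathbb{R}^{d+e})$ almost surely. For the other pairs, $I[x,z]_{s,t}=\int_s^tx_{s,r}\otimes dz_r$ (Young integral), $U^2=I[u,u]$ and $V^2=I[v,v]$. *)

theory Defs
  imports "HOL-Probability.Probability"
begin

section \<open>Tensors, increments and rough paths\<close>

type_synonym 'n rough = "(real \<Rightarrow> real \<Rightarrow> real ^ 'n) \<times> (real \<Rightarrow> real \<Rightarrow> real ^ 'n ^ 'n)"

text \<open>The tensor product of two coordinate spaces is identified with a space of matrices; the
  Euclidean norm of \<^typ>\<open>real ^ 'n ^ 'm\<close> is then the Hilbert--Schmidt norm.\<close>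

definition tensor :: "real ^ 'm \<Rightarrow> real ^ 'n \<Rightarrow> real ^ 'n ^ 'm" (infixl \<open>\<otimes>\<^sub>v\<close> 70)
  where "x \<otimes>\<^sub>v y = (\<chi> i j. x $ i * y $ j)"

definition join_vec :: "real ^ 'd \<Rightarrow> real ^ 'e \<Rightarrow> real ^ ('d + 'e)"
  where "join_vec x y = (\<chi> k. case k of Inl i \<Rightarrow> x $ i | Inr j \<Rightarrow> y $ j)"

definition block_matrix ::
    "real ^ 'd ^ 'd \<Rightarrow> real ^ 'e ^ 'd \<Rightarrow> real ^ 'd ^ 'e \<Rightarrow> real ^ 'e ^ 'e
      \<Rightarrow> real ^ ('d + 'e) ^ ('d + 'e)"
  where "block_matrix A B C D = (\<chi> k l. case k of
      Inl i \<Rightarrow> (case l of Inl i' \<Rightarrow> A $ i $ i' | Inr j' \<Rightarrow> B $ i $ j')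
    | Inr j \<Rightarrow> (case l of Inl i' \<Rightarrow> C $ j $ i' | Inr j' \<Rightarrow> D $ j $ j'))"

definition incr :: "(real \<Rightarrow> 'v :: ab_group_add) \<Rightarrow> real \<Rightarrow> real \<Rightarrow> 'v"
  where "incr x s t = x t - x s"

definition rough_paths :: "real \<Rightarrow> real \<Rightarrow> 'n :: finite rough set"
  where "rough_paths T \<alpha> = {(X1, X2).
      continuous_on {(s, t). 0 \<le> s \<and> s \<le> t \<and> t \<le> T} (\<lambda>(s, t). (X1 s t, X2 s t)) \<and>
      (\<forall>s r t. 0 \<le> s \<and> s \<le> r \<and> r \<le> t \<and> t \<le> T \<longrightarrow>
         X1 s t = X1 s r + X1 r t \<and>
         X2 s t = X2 s r + X2 r t + X1 s r \<otimes>\<^sub>v X1 r t) \<and>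
      bdd_above {norm (X1 s t) / (t - s) powr \<alpha> | s t. 0 \<le> s \<and> s < t \<and> t \<le> T} \<and>
      bdd_above {norm (X2 s t) / (t - s) powr (2 * \<alpha>) | s t. 0 \<le> s \<and> s < t \<and> t \<le> T}}"

definition rough_dist :: "real \<Rightarrow> real \<Rightarrow> 'n :: finite rough \<Rightarrow> 'n rough \<Rightarrow> ennreal"
  where "rough_dist T \<alpha> X Y =
      (SUP (s, t) \<in> {(s, t). 0 \<le> s \<and> s < t \<and> t \<le> T}.
         ennreal (norm (fst X s t - fst Y s t) / (t - s) powr \<alpha>)) +
      (SUP (s, t) \<in> {(s, t). 0 \<le> s \<and> s < t \<and> t \<le> T}.
         ennreal (norm (snd X s t - snd Y s t) / (t - s) powr (2 * \<alpha>)))"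


section \<open>Young integration\<close>

definition interval_partition :: "real \<Rightarrow> real \<Rightarrow> nat \<Rightarrow> (nat \<Rightarrow> real) \<Rightarrow> bool"
  where "interval_partition s t n \<tau> \<longleftrightarrow> \<tau> 0 = s \<and> \<tau> n = t \<and> (\<forall>i<n. \<tau> i \<le> \<tau> (Suc i))"

definition finite_variation ::
    "real \<Rightarrow> real \<Rightarrow> real \<Rightarrow> (real \<Rightarrow> 'v :: real_normed_vector) \<Rightarrow> bool"
  where "finite_variation p s t x \<longleftrightarrow>
      bdd_above {\<Sum>i<n. norm (x (\<tau> (Suc i)) - x (\<tau> i)) powr p | n \<tau>. interval_partition s t n \<tau>}"

text \<open>The integral of \<open>x\<^sub>s\<^sub>,\<^sub>r \<otimes> dz\<^sub>r\<close> over \<open>[s, t]\<close> as the limit of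
  Riemann--Stieltjes sums, with arbitrary tags, as the mesh tends to zero.\<close>

definition has_young_integral ::
    "(real \<Rightarrow> real ^ 'm) \<Rightarrow> (real \<Rightarrow> real ^ 'n) \<Rightarrow> real \<Rightarrow> real \<Rightarrow> real ^ 'n ^ 'm \<Rightarrow> bool"
  where "has_young_integral x z s t J \<longleftrightarrow>
      (\<forall>\<epsilon>>0. \<exists>\<delta>>0. \<forall>n \<tau> \<xi>.
         interval_partition s t n \<tau> \<and>
         (\<forall>i<n. \<tau> (Suc i) - \<tau> i < \<delta> \<and> \<tau> i \<le> \<xi> i \<and> \<xi> i \<le> \<tau> (Suc i)) \<longrightarrow>
         norm ((\<Sum>i<n. incr x s (\<xi> i) \<otimes>\<^sub>v incr z (\<tau> i) (\<tau> (Suc i))) - J) < \<epsilon>)"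

definition young_integral ::
    "(real \<Rightarrow> real ^ 'm) \<Rightarrow> (real \<Rightarrow> real ^ 'n) \<Rightarrow> real \<Rightarrow> real \<Rightarrow> real ^ 'n ^ 'm"
  where "young_integral x z s t = (THE J. has_young_integral x z s t J)"

text \<open>Well-definedness in the variation sense: complementary variation regularity of the two
  paths, together with convergence of the Riemann--Stieltjes sums on every subinterval.\<close>

definition young_integrable :: "real \<Rightarrow> (real \<Rightarrow> real ^ 'm) \<Rightarrow> (real \<Rightarrow> real ^ 'n) \<Rightarrow> bool"
  where "young_integrable T x z \<longleftrightarrow>
      continuous_on {0..T} x \<and> continuous_on {0..T} z \<and>
      (\<exists>p\<ge>1. \<exists>q\<ge>1. 1 / p + 1 / q > 1 \<and> finite_variation p 0 T x \<and> finite_variation q 0 T z) \<and>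
      (\<forall>s t. 0 \<le> s \<and> s \<le> t \<and> t \<le> T \<longrightarrow> (\<exists>J. has_young_integral x z s t J))"


section \<open>Gaussian processes\<close>

definition normal_rv :: "'a measure \<Rightarrow> real \<Rightarrow> real \<Rightarrow> ('a \<Rightarrow> real) \<Rightarrow> bool"
  where "normal_rv M \<mu> V Y \<longleftrightarrow> V \<ge> 0 \<and> Y \<in> borel_measurable M \<and>
      (if V = 0 then AE \<omega> in M. Y \<omega> = \<mu>
       else distributed M lborel Y (\<lambda>x. ennreal (normal_density \<mu> (sqrt V) x)))"

definition gaussian_process :: "'a measure \<Rightarrow> real set \<Rightarrow> (real \<Rightarrow> 'a \<Rightarrow> real) \<Rightarrow> bool"
  where "gaussian_process M I X \<longleftrightarrow>
      (\<forall>J c. finite J \<and> J \<subseteq> I \<longrightarrow> (\<exists>\<mu> V. normal_rv M \<mu> V (\<lambda>\<omega>. \<Sum>t\<in>J. c t * X t \<omega>)))"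

definition fbm_cov :: "real \<Rightarrow> real \<Rightarrow> real \<Rightarrow> real"
  where "fbm_cov H s t = (t powr (2 * H) + s powr (2 * H) - \<bar>t - s\<bar> powr (2 * H)) / 2"

definition fbm_real :: "'a measure \<Rightarrow> real \<Rightarrow> real \<Rightarrow> (real \<Rightarrow> 'a \<Rightarrow> real) \<Rightarrow> bool"
  where "fbm_real M T H X \<longleftrightarrow>
      gaussian_process M {0..T} X \<and>
      (\<forall>t\<in>{0..T}. (\<integral>\<omega>. X t \<omega> \<partial>M) = 0) \<and>
      (\<forall>s\<in>{0..T}. \<forall>t\<in>{0..T}. (\<integral>\<omega>. X s \<omega> * X t \<omega> \<partial>M) = fbm_cov H s t) \<and>
      (AE \<omega> in M. continuous_on {0..T} (\<lambda>t. X t \<omega>))"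

definition bm_real :: "'a measure \<Rightarrow> real \<Rightarrow> (real \<Rightarrow> 'a \<Rightarrow> real) \<Rightarrow> bool"
  where "bm_real M T X \<longleftrightarrow>
      (\<forall>t\<in>{0..T}. X t \<in> borel_measurable M) \<and>
      (AE \<omega> in M. X 0 \<omega> = 0) \<and>
      (\<forall>n \<tau>. interval_partition 0 T n \<tau> \<longrightarrow>
         prob_space.indep_vars M (\<lambda>_. borel) (\<lambda>i \<omega>. X (\<tau> (Suc i)) \<omega> - X (\<tau> i) \<omega>) {..<n}) \<and>
      (\<forall>s t. 0 \<le> s \<and> s \<le> t \<and> t \<le> T \<longrightarrow> normal_rv M 0 (t - s) (\<lambda>\<omega>. X t \<omega> - X s \<omega>)) \<and>
      (AE \<omega> in M. continuous_on {0..T} (\<lambda>t. X t \<omega>))"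

definition path_on :: "real \<Rightarrow> (real \<Rightarrow> 'a \<Rightarrow> 'v) \<Rightarrow> 'a \<Rightarrow> real \<Rightarrow> 'v"
  where "path_on T X \<omega> = (\<lambda>t\<in>{0..T}. X t \<omega>)"

abbreviation path_space :: "real \<Rightarrow> (real \<Rightarrow> 'v :: topological_space) measure"
  where "path_space T \<equiv> PiM {0..T} (\<lambda>_. borel)"

definition independent_components :: "'a measure \<Rightarrow> real \<Rightarrow> (real \<Rightarrow> 'a \<Rightarrow> real ^ 'n) \<Rightarrow> bool"
  where "independent_components M T X \<longleftrightarrow>
      prob_space.indep_vars M (\<lambda>_. path_space T) (\<lambda>i. path_on T (\<lambda>t \<omega>. X t \<omega> $ i)) UNIV"

definition fractional_brownian_motion ::
    "'a measure \<Rightarrow> real \<Rightarrow> real \<Rightarrow> (real \<Rightarrow> 'a \<Rightarrow> real ^ 'd) \<Rightarrow> bool"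
  where "fractional_brownian_motion M T H b \<longleftrightarrow>
      (\<forall>i. fbm_real M T H (\<lambda>t \<omega>. b t \<omega> $ i)) \<and> independent_components M T b"

definition standard_brownian_motion ::
    "'a measure \<Rightarrow> real \<Rightarrow> (real \<Rightarrow> 'a \<Rightarrow> real ^ 'e) \<Rightarrow> bool"
  where "standard_brownian_motion M T w \<longleftrightarrow>
      (\<forall>j. bm_real M T (\<lambda>t \<omega>. w t \<omega> $ j)) \<and> independent_components M T w"

definition independent_processes ::
    "'a measure \<Rightarrow> real \<Rightarrow> (real \<Rightarrow> 'a \<Rightarrow> real ^ 'd) \<Rightarrow> (real \<Rightarrow> 'a \<Rightarrow> real ^ 'e) \<Rightarrow> bool"
  where "independent_processes M T X Y \<longleftrightarrow>
      prob_space.indep_set M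
        (sets (vimage_algebra (space M) (path_on T X) (path_space T)))
        (sets (vimage_algebra (space M) (path_on T Y) (path_space T)))"


section \<open>Cameron--Martin spaces\<close>

text \<open>The reproducing kernel Hilbert space of a positive semidefinite kernel \<open>K\<close> on \<open>I\<close>, in the
  Moore--Aronszajn form: the span of the functions \<open>K a\<close> (\<open>a \<in> I\<close>) carries the inner product
  determined by \<open>\<langle>K a, K a'\<rangle> = K a a'\<close>, and its completion is realised by the pointwise limits of
  sequences that are Cauchy for the induced norm. A finite combination of kernel functions is given
  by its coefficient function \<open>c\<close>, supported in a finite set \<open>A\<close>.\<close>

definition kernel_coeffs :: "real set \<Rightarrow> (real \<Rightarrow> real) set"
  where "kernel_coeffs I = {c. finite {a. c a \<noteq> 0} \<and> {a. c a \<noteq> 0} \<subseteq> I}"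

definition kernel_comb :: "(real \<Rightarrow> real \<Rightarrow> real) \<Rightarrow> (real \<Rightarrow> real) \<Rightarrow> real \<Rightarrow> real"
  where "kernel_comb K c t = (\<Sum>a\<in>{a. c a \<noteq> 0}. c a * K a t)"

definition kernel_sqnorm :: "(real \<Rightarrow> real \<Rightarrow> real) \<Rightarrow> (real \<Rightarrow> real) \<Rightarrow> real"
  where "kernel_sqnorm K c = (\<Sum>a\<in>{a. c a \<noteq> 0}. \<Sum>a'\<in>{a. c a \<noteq> 0}. c a * c a' * K a a')"

definition rkhs :: "real set \<Rightarrow> (real \<Rightarrow> real \<Rightarrow> real) \<Rightarrow> (real \<Rightarrow> real) set"
  where "rkhs I K = {h. \<exists>c :: nat \<Rightarrow> real \<Rightarrow> real.
      (\<forall>n. c n \<in> kernel_coeffs I) \<and>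
      (\<forall>\<epsilon>>0. \<exists>N. \<forall>m\<ge>N. \<forall>n\<ge>N. kernel_sqnorm K (\<lambda>a. c m a - c n a) < \<epsilon>) \<and>
      (\<forall>t\<in>I. (\<lambda>n. kernel_comb K (c n) t) \<longlonglongrightarrow> h t)}"

text \<open>The components of the process being independent with the same law, its Cameron--Martin space
  is the direct sum of copies of the scalar one. Elements matter only through their values on
  \<open>[0, T]\<close>.\<close>

definition cameron_martin :: "real \<Rightarrow> real \<Rightarrow> (real \<Rightarrow> real ^ 'n) set"
  where "cameron_martin T H = {h. \<forall>i. (\<lambda>t. h t $ i) \<in> rkhs {0..T} (fbm_cov H)}"


section \<open>Ito integration\<close>

definition joint_filtration ::
    "'a measure \<Rightarrow> (real \<Rightarrow> 'a \<Rightarrow> real ^ 'd) \<Rightarrow> (real \<Rightarrow> 'a \<Rightarrow> real ^ 'e) \<Rightarrow> real \<Rightarrow> 'a measure"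
  where "joint_filtration M b w t =
      vimage_algebra (space M) (path_on t (\<lambda>r \<omega>. (b r \<omega>, w r \<omega>))) (path_space t)"

definition simple_integrand ::
    "'a measure \<Rightarrow> (real \<Rightarrow> 'a measure) \<Rightarrow> real \<Rightarrow> real \<Rightarrow> nat \<Rightarrow> (nat \<Rightarrow> real)
      \<Rightarrow> (nat \<Rightarrow> 'a \<Rightarrow> real) \<Rightarrow> bool"
  where "simple_integrand M F s t n \<tau> \<xi> \<longleftrightarrow>
      interval_partition s t n \<tau> \<and>
      (\<forall>i<n. \<xi> i \<in> borel_measurable (F (\<tau> i)) \<and> (\<exists>C. \<forall>\<omega>\<in>space M. \<bar>\<xi> i \<omega>\<bar> \<le> C))"

text \<open>\<open>ito_integral M F s t f W Y\<close>: the random variable \<open>Y\<close> is (a version of) the Ito integral of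
  \<open>f\<close> against the Brownian motion \<open>W\<close> over \<open>[s, t]\<close>, i.e. the limit in \<open>L\<^sup>2(P)\<close> of the elementary
  integrals of adapted simple processes approximating \<open>f\<close> in \<open>L\<^sup>2(dr \<otimes> P)\<close>.\<close>

definition ito_integral ::
    "'a measure \<Rightarrow> (real \<Rightarrow> 'a measure) \<Rightarrow> real \<Rightarrow> real \<Rightarrow> (real \<Rightarrow> 'a \<Rightarrow> real)
      \<Rightarrow> (real \<Rightarrow> 'a \<Rightarrow> real) \<Rightarrow> ('a \<Rightarrow> real) \<Rightarrow> bool"
  where "ito_integral M F s t f W Y \<longleftrightarrow>
      Y \<in> borel_measurable M \<and>
      (\<exists>(n :: nat \<Rightarrow> nat) \<tau> \<xi>.
         (\<forall>k. simple_integrand M F s t (n k) (\<tau> k) (\<xi> k)) \<and>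
         (\<lambda>k. \<integral>\<^sup>+r\<in>{s..t}. (\<integral>\<^sup>+\<omega>. ennreal
            (((\<Sum>i<n k. \<xi> k i \<omega> * indicator {\<tau> k i <.. \<tau> k (Suc i)} r) - f r \<omega>)\<^sup>2) \<partial>M) \<partial>lborel)
           \<longlonglongrightarrow> 0 \<and>
         (\<lambda>k. \<integral>\<^sup>+\<omega>. ennreal
            (((\<Sum>i<n k. \<xi> k i \<omega> * (W (\<tau> k (Suc i)) \<omega> - W (\<tau> k i) \<omega>)) - Y \<omega>)\<^sup>2) \<partial>M)
           \<longlonglongrightarrow> 0)"

text \<open>\<open>Y\<close> is the two-parameter process whose value at \<open>(s, t)\<close> is the Ito integral of
  \<open>X\<^sub>s\<^sub>,\<^sub>r \<otimes> dW\<^sub>r\<close> over \<open>[s, t]\<close>, entry by entry.\<close>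

definition ito_tensor_integral ::
    "'a measure \<Rightarrow> (real \<Rightarrow> 'a measure) \<Rightarrow> real \<Rightarrow> (real \<Rightarrow> 'a \<Rightarrow> real ^ 'm)
      \<Rightarrow> (real \<Rightarrow> 'a \<Rightarrow> real ^ 'n) \<Rightarrow> (real \<Rightarrow> real \<Rightarrow> 'a \<Rightarrow> real ^ 'n ^ 'm) \<Rightarrow> bool"
  where "ito_tensor_integral M F T X W Y \<longleftrightarrow>
      (\<forall>s t. 0 \<le> s \<and> s \<le> t \<and> t \<le> T \<longrightarrow>
        (\<forall>i j. ito_integral M F s t (\<lambda>r \<omega>. X r \<omega> $ i - X s \<omega> $ i) (\<lambda>r \<omega>. W r \<omega> $ j)
          (\<lambda>\<omega>. Y s t \<omega> $ i $ j)))"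


section \<open>The lift of mixed fractional Brownian motion\<close>

definition dyadic_interpolation ::
    "real \<Rightarrow> nat \<Rightarrow> (real \<Rightarrow> 'v :: real_vector) \<Rightarrow> real \<Rightarrow> 'v"
  where "dyadic_interpolation T n x t =
      (let h = T / 2 ^ n; k = of_int \<lfloor>t / h\<rfloor>
       in x (k * h) + ((t - k * h) / h) *\<^sub>R (x ((k + 1) * h) - x (k * h)))"

text \<open>The canonical geometric lift of a Gaussian path: the almost sure limit, in the
  \<open>\<alpha>\<close>-Hoelder rough path distance, of the lifts of its dyadic piecewise linear interpolations.\<close>

definition canonical_geometric_lift ::
    "'a measure \<Rightarrow> real \<Rightarrow> real \<Rightarrow> (real \<Rightarrow> 'a \<Rightarrow> real ^ 'd)
      \<Rightarrow> (real \<Rightarrow> real \<Rightarrow> 'a \<Rightarrow> real ^ 'd ^ 'd) \<Rightarrow> bool"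
  where "canonical_geometric_lift M T \<alpha> b B2 \<longleftrightarrow>
      (AE \<omega> in M.
         (incr (\<lambda>t. b t \<omega>), \<lambda>s t. B2 s t \<omega>) \<in> rough_paths T \<alpha> \<and>
         (\<lambda>n. let x = dyadic_interpolation T n (\<lambda>t. b t \<omega>)
              in rough_dist T \<alpha> (incr x, young_integral x x)
                   (incr (\<lambda>t. b t \<omega>), \<lambda>s t. B2 s t \<omega>)) \<longlonglongrightarrow> 0)"

text \<open>In the lower left block the integral of \<open>dw\<^sub>r \<otimes> b\<^sub>s\<^sub>,\<^sub>r\<close> is the transpose of that of
  \<open>b\<^sub>s\<^sub>,\<^sub>r \<otimes> dw\<^sub>r\<close>. The Ito integrals determine each \<open>\<Lambda> \<omega>\<close> only up to a null set depending on
  \<open>(s, t)\<close>; the versions are a matter of choice.\<close>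

definition mixed_fbm_lift ::
    "'a measure \<Rightarrow> real \<Rightarrow> real \<Rightarrow> (real \<Rightarrow> 'a \<Rightarrow> real ^ 'd) \<Rightarrow> (real \<Rightarrow> 'a \<Rightarrow> real ^ 'e)
      \<Rightarrow> ('a \<Rightarrow> ('d + 'e) rough) \<Rightarrow> bool"
  where "mixed_fbm_lift M T \<alpha> b w \<Lambda> \<longleftrightarrow>
      (\<exists>B2 BW W2.
         canonical_geometric_lift M T \<alpha> b B2 \<and>
         ito_tensor_integral M (joint_filtration M b w) T b w BW \<and>
         ito_tensor_integral M (joint_filtration M b w) T w w W2 \<and>
         (\<forall>\<omega>\<in>space M. \<forall>s t. 0 \<le> s \<and> s \<le> t \<and> t \<le> T \<longrightarrow>
            fst (\<Lambda> \<omega>) s t = join_vec (incr (\<lambda>r. b r \<omega>) s t) (incr (\<lambda>r. w r \<omega>) s t) \<and>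
            snd (\<Lambda> \<omega>) s t = block_matrix
              (B2 s t \<omega>)
              (BW s t \<omega>)
              (incr (\<lambda>r. w r \<omega>) s t \<otimes>\<^sub>v incr (\<lambda>r. b r \<omega>) s t - transpose (BW s t \<omega>))
              (W2 s t \<omega>)))"


section \<open>Translation\<close>

text \<open>\<open>\<beta>\<close> and \<open>\<gamma>\<close> are sample paths of the two components of the process.\<close>

definition young_translation ::
    "(real \<Rightarrow> real ^ 'd) \<Rightarrow> (real \<Rightarrow> real ^ 'e) \<Rightarrow> (real \<Rightarrow> real ^ 'd) \<Rightarrow> (real \<Rightarrow> real ^ 'e)
      \<Rightarrow> ('d + 'e) rough \<Rightarrow> ('d + 'e) rough"
  where "young_translation \<beta> \<gamma> u v X =
      (incr (\<lambda>t. join_vec (\<beta> t + u t) (\<gamma> t + v t)),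
       \<lambda>s t. snd X s t + block_matrix
         (young_integral \<beta> u s t + young_integral u \<beta> s t + young_integral u u s t)
         (young_integral \<beta> v s t + young_integral u \<gamma> s t + young_integral u v s t)
         (young_integral \<gamma> u s t + young_integral v \<beta> s t + young_integral v u s t)
         (young_integral \<gamma> v s t + young_integral v \<gamma> s t + young_integral v v s t))"

definition young_translation_defined ::
    "real \<Rightarrow> (real \<Rightarrow> real ^ 'd) \<Rightarrow> (real \<Rightarrow> real ^ 'e) \<Rightarrow> (real \<Rightarrow> real ^ 'd) \<Rightarrow> (real \<Rightarrow> real ^ 'e)
      \<Rightarrow> bool"
  where "young_translation_defined T \<beta> \<gamma> u v \<longleftrightarrow>
      young_integrable T \<beta> u \<and> young_integrable T u \<beta> \<and> young_integrable T u u \<and>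
      young_integrable T \<beta> v \<and> young_integrable T u \<gamma> \<and> young_integrable T u v \<and>
      young_integrable T \<gamma> u \<and> young_integrable T v \<beta> \<and> young_integrable T v u \<and>
      young_integrable T \<gamma> v \<and> young_integrable T v \<gamma> \<and> young_integrable T v v"

end

theory Submission
  imports Defs
begin

text \<open>If \<open>x\<close> is \<open>\<alpha>\<close>-Hoelder and \<open>h\<close> is a Cameron--Martin path of the fractional Brownian
  motion, then \<open>|h\<^sub>s\<^sub>,\<^sub>t|\<^sup>2 \<le> E(s, t) (t - s)\<^sup>2\<^sup>H\<close> for a superadditive \<open>E\<close>: since disjoint increments are
  negatively correlated when \<open>H \<le> 1/2\<close>, the sums of \<open>|h\<^sub>s\<^sub>,\<^sub>t|\<^sup>2 / (t - s)\<^sup>2\<^sup>H\<close> over partitions are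
  bounded by a multiple of the squared norm of \<open>h\<close>, and \<open>E\<close> is their supremum. Hence
  \<open>|x\<^sub>s\<^sub>,\<^sub>t| |h\<^sub>s\<^sub>,\<^sub>t|\<close> is bounded by \<open>(t - s)\<^sup>\<alpha>\<^sup>+\<^sup>H E(s, t)\<^sup>1\<^sup>/\<^sup>2\<close>, which is the power \<open>\<theta> = \<alpha> + H + 1/2 > 1\<close> of
  a superadditive function; sewing yields the Young integrals of \<open>x\<close> against \<open>h\<close> and of \<open>h\<close> against
  \<open>x\<close>, and they are of order \<open>(t - s)\<^sup>\<alpha>\<^sup>+\<^sup>H\<close>, hence \<open>2\<alpha>\<close>-Hoelder. The Chen relations of the
  summands add up to that of the translated path, because
  \<open>y \<otimes> y + y \<otimes> h + h \<otimes> y + h \<otimes> h = (y + h) \<otimes> (y + h)\<close>. Paths in the Cameron--Martin space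
  of Brownian motion satisfy the same estimate with \<open>1/2\<close>, a fortiori with \<open>H\<close>.\<close>

subsection \<open>Sewing\<close>

text \<open>Nonnegative and superadditive, with no continuity included: the control obtained below
  as a supremum of energies comes without it, and smallness near the diagonal is supplied
  separately.\<close>

definition control :: "real \<Rightarrow> (real \<Rightarrow> real \<Rightarrow> real) \<Rightarrow> bool"
  where "control T \<omega> \<longleftrightarrow>
      (\<forall>s t. 0 \<le> s \<and> s \<le> t \<and> t \<le> T \<longrightarrow> 0 \<le> \<omega> s t) \<and>
      (\<forall>s r t. 0 \<le> s \<and> s \<le> r \<and> r \<le> t \<and> t \<le> T \<longrightarrow> \<omega> s r + \<omega> r t \<le> \<omega> s t)"

lemma control_nonneg: "control T \<omega> \<Longrightarrow> 0 \<le> s \<Longrightarrow> s \<le> t \<Longrightarrow> t \<le> T \<Longrightarrow> 0 \<le> \<omega> s t"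
  by (simp add: control_def)

lemma control_superadditive:
  "control T \<omega> \<Longrightarrow> 0 \<le> s \<Longrightarrow> s \<le> r \<Longrightarrow> r \<le> t \<Longrightarrow> t \<le> T \<Longrightarrow> \<omega> s r + \<omega> r t \<le> \<omega> s t"
  by (simp add: control_def)

lemma control_mono:
  assumes "control T \<omega>" "0 \<le> s" "s \<le> s'" "s' \<le> t'" "t' \<le> t" "t \<le> T"
  shows "\<omega> s' t' \<le> \<omega> s t"
  using control_superadditive[OF assms(1), of s s' t] control_superadditive[OF assms(1), of s' t' t]
    control_nonneg[OF assms(1), of s s'] control_nonneg[OF assms(1), of t' t] assms
  by linarith

lemma control_diag: "control T \<omega> \<Longrightarrow> 0 \<le> s \<Longrightarrow> s \<le> T \<Longrightarrow> \<omega> s s = 0"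
  using control_superadditive[of T \<omega> s s s] control_nonneg[of T \<omega> s s] by simp

section \<open>Partitions, uniform grids and restriction to subintervals\<close>

lemma interval_partition_mono:
  assumes "interval_partition s t n \<tau>" "i \<le> j" "j \<le> n"
  shows "\<tau> i \<le> \<tau> j"
  using assms(2,3)
proof (induction j rule: dec_induct)
  case (step j)
  then show ?case
    using assms(1) unfolding interval_partition_def
    by (metis Suc_le_lessD Suc_leD order_trans)
qed simp

lemma interval_partition_bounds:
  assumes "interval_partition s t n \<tau>" "i \<le> n"
  shows "s \<le> \<tau> i" "\<tau> i \<le> t"
  using interval_partition_mono[OF assms(1), of 0 i] interval_partition_mono[OF assms(1), of i n] assms
  by (auto simp: interval_partition_def)

lemma interval_partition_step:
  "interval_partition s t n \<tau> \<Longrightarrow> i < n \<Longrightarrow> \<tau> i \<le> \<tau> (Suc i)"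
  by (simp add: interval_partition_def)

lemma sum_control_le:
  assumes "control T \<omega>" "interval_partition s t n \<tau>" "0 \<le> s" "t \<le> T"
  shows "(\<Sum>i<n. \<omega> (\<tau> i) (\<tau> (Suc i))) \<le> \<omega> s t"
proof -
  have "(\<Sum>i<k. \<omega> (\<tau> i) (\<tau> (Suc i))) \<le> \<omega> s (\<tau> k)" if "k \<le> n" for k
    using that
  proof (induction k)
    case 0
    have "s \<le> t"
      using interval_partition_bounds[OF assms(2), of 0] by linarith
    then show ?case
      using assms control_diag[OF assms(1), of s] by (simp add: interval_partition_def)
  next
    case (Suc k)
    then show ?case
      using control_superadditive[OF assms(1), of s "\<tau> k" "\<tau> (Suc k)"]
        interval_partition_bounds[OF assms(2), of k] interval_partition_bounds[OF assms(2), of "Suc k"]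
        interval_partition_step[OF assms(2), of k] assms(3,4)
      by simp
  qed
  from this[of n] show ?thesis
    using assms(2) by (simp add: interval_partition_def)
qed

text \<open>There are \<open>Suc n\<close> cells, so the denominator never vanishes and every
  \<open>n\<close> gives a grid.\<close>

definition uniform_grid :: "real \<Rightarrow> real \<Rightarrow> nat \<Rightarrow> nat \<Rightarrow> real"
  where "uniform_grid s t n i = s + (t - s) * real i / real (Suc n)"

lemma uniform_grid_step:
  "uniform_grid s t n (Suc i) - uniform_grid s t n i = (t - s) / real (Suc n)"
  unfolding uniform_grid_def of_nat_Suc[of i] distrib_left add_divide_distrib by simp

lemma interval_partition_uniform_grid:
  assumes "s \<le> t"
  shows "interval_partition s t (Suc n) (uniform_grid s t n)"
proof -
  have "uniform_grid s t n i \<le> uniform_grid s t n (Suc i)" for i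
  proof -
    have "0 \<le> (t - s) / real (Suc n)"
      using assms by simp
    then show ?thesis
      using uniform_grid_step[of s t n i] by linarith
  qed
  then show ?thesis
    by (simp add: interval_partition_def uniform_grid_def del: of_nat_Suc)
qed

lemma uniform_grid_fine:
  assumes "s \<le> t" "0 < \<delta>"
  shows "\<forall>\<^sub>F n in sequentially. \<forall>i. uniform_grid s t n (Suc i) - uniform_grid s t n i < \<delta>"
proof -
  have "(\<lambda>n. (t - s) / real (Suc n)) \<longlonglongrightarrow> 0"
    using LIMSEQ_Suc[OF lim_const_over_n] by blast
  then have "\<forall>\<^sub>F n in sequentially. (t - s) / real (Suc n) < \<delta>"
    using assms(2) by (rule order_tendstoD)
  then show ?thesis
    by (simp add: uniform_grid_step)
qed

text \<open>Projection onto \<open>[a, b]\<close>. Clamping a partition restricts it to a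
  subinterval without reindexing; points outside only produce degenerate cells.\<close>

definition clamp1 :: "real \<Rightarrow> real \<Rightarrow> real \<Rightarrow> real"
  where "clamp1 a b x = max a (min x b)"

lemma interval_partition_clamp1:
  assumes "interval_partition s t n \<tau>" "s \<le> a" "a \<le> b" "b \<le> t"
  shows "interval_partition a b n (\<lambda>i. clamp1 a b (\<tau> i))"
  using assms unfolding interval_partition_def clamp1_def
  by (auto intro!: max.mono min.mono)

lemma clamp1_step_le: "x \<le> y \<Longrightarrow> clamp1 a b y - clamp1 a b x \<le> y - x"
  by (auto simp: clamp1_def max_def min_def)

text \<open>The germ \<open>A\<close> is additive up to \<open>\<omega> powr \<theta>\<close>. The
  assumption \<open>small\<close> takes the place of continuity of the control at the
  diagonal.\<close>

locale sewing =
  fixes T \<theta> :: real and \<omega> :: "real \<Rightarrow> real \<Rightarrow> real" and A :: "real \<Rightarrow> real \<Rightarrow> 'v :: banach"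
  assumes control: "control T \<omega>"
    and exponent: "1 < \<theta>"
    and defect: "0 \<le> p \<Longrightarrow> p \<le> r \<Longrightarrow> r \<le> q \<Longrightarrow> q \<le> T \<Longrightarrow> norm (A p q - A p r - A r q) \<le> \<omega> p q powr \<theta>"
    and small: "0 < \<epsilon> \<Longrightarrow> \<exists>\<delta>>0. \<forall>p q. 0 \<le> p \<and> p \<le> q \<and> q \<le> T \<and> q - p < \<delta> \<longrightarrow> \<omega> p q < \<epsilon>"
begin

text \<open>The fixed point of \<open>K = 2 * K * 2 powr - \<theta> + 2\<close>: two pieces carrying
  at most half of the control, each with constant \<open>K\<close>, and two defects.\<close>

definition K :: real
  where "K = 2 / (1 - 2 powr (1 - \<theta>))"

lemma K_eq: "K * 2 powr (1 - \<theta>) + 2 = K" and K_pos: "0 < K"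
proof -
  have "(2 :: real) powr (1 - \<theta>) < 2 powr 0"
    using exponent by (intro powr_less_mono) auto
  then have "2 powr (1 - \<theta>) < 1"
    by simp
  moreover have "2 / (1 - x) * x + 2 = 2 / (1 - x)" if "x < 1" for x :: real
    using that by (simp add: divide_simps)
  ultimately show "K * 2 powr (1 - \<theta>) + 2 = K" "0 < K"
    unfolding K_def by auto
qed

text \<open>The defect at \<open>p = r = q\<close> is \<open>- A p p\<close>, while the control
  vanishes on the diagonal.\<close>

lemma A_diag: "0 \<le> p \<Longrightarrow> p \<le> T \<Longrightarrow> A p p = 0"
  using defect[of p p p] control_diag[OF control, of p] by simp

definition riemann :: "nat \<Rightarrow> (nat \<Rightarrow> real) \<Rightarrow> 'v"
  where "riemann n \<tau> = (\<Sum>i<n. A (\<tau> i) (\<tau> (Suc i)))"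

definition remainder :: "nat \<Rightarrow> (nat \<Rightarrow> real) \<Rightarrow> real"
  where "remainder n \<tau> = (\<Sum>i<n. \<omega> (\<tau> i) (\<tau> (Suc i)) powr \<theta>)"

text \<open>Cutting just before the first point where half of \<open>\<omega> s t\<close> is exceeded leaves two pieces
  on which the control is at most half.\<close>

lemma riemann_estimate:
  assumes "interval_partition s t n \<tau>" "0 \<le> s" "t \<le> T"
  shows "norm (riemann n \<tau> - A s t) \<le> K * \<omega> s t powr \<theta>"
  using assms
proof (induction n arbitrary: s t \<tau> rule: less_induct)
  case (less n)
  note part = \<open>interval_partition s t n \<tau>\<close>
  have st: "s \<le> t"
    using interval_partition_bounds[OF part, of 0] by linarith
  show ?case
  proof (cases "n = 0")
    case True
    then have "s = t"
      using part by (simp add: interval_partition_def)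
    then show ?thesis
      using less.prems A_diag[of t] K_pos True by (simp add: riemann_def)
  next
    case False
    let ?S = "{k. k < n \<and> \<omega> s (\<tau> k) \<le> \<omega> s t / 2}"
    have fin: "finite ?S"
      by simp
    have "0 \<in> ?S"
      using False part control_diag[OF control, of s] control_nonneg[OF control, of s t] less.prems st
      by (simp add: interval_partition_def)
    then have ne: "?S \<noteq> {}"
      by blast
    \<comment> \<open>The last index below \<open>n\<close> up to which at most half of the control
      is used; the cell from \<open>k\<close> to \<open>Suc k\<close> is treated separately.\<close>
    define k where "k = Max ?S"
    have k: "k < n" "\<omega> s (\<tau> k) \<le> \<omega> s t / 2"
      using Max_in[OF fin ne] by (auto simp: k_def)
    define m where "m = n - Suc k"
    have n: "n = Suc (k + m)"
      using k by (simp add: m_def)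
    have bk: "s \<le> \<tau> k" "\<tau> k \<le> \<tau> (Suc k)" "\<tau> (Suc k) \<le> t"
      using interval_partition_bounds[OF part, of k] interval_partition_bounds[OF part, of "Suc k"]
        interval_partition_step[OF part, of k] k by auto
    \<comment> \<open>If \<open>Suc k\<close> is below \<open>n\<close>, maximality of
      \<open>k\<close> puts more than half of the control to its left, and superadditivity leaves at
      most half on its right. Otherwise the right piece is a single point.\<close>
    have right: "\<omega> (\<tau> (Suc k)) t \<le> \<omega> s t / 2"
    proof (cases "Suc k < n")
      case True
      have "Suc k \<notin> ?S"
        using Max_ge[OF fin, of "Suc k", folded k_def] by linarith
      then show ?thesis
        using True control_superadditive[OF control, of s "\<tau> (Suc k)" t] bk less.prems by simp
    next
      case False
      then have "\<tau> (Suc k) = t"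
        using k part by (metis Suc_lessI interval_partition_def)
      then show ?thesis
        using less.prems control_diag[OF control, of t] control_nonneg[OF control, of s t] st by simp
    qed
    have p1: "interval_partition s (\<tau> k) k \<tau>"
      using part k by (auto simp: interval_partition_def)
    have p2: "interval_partition (\<tau> (Suc k)) t m (\<lambda>i. \<tau> (i + Suc k))"
      using part n by (auto simp: interval_partition_def add.commute)
    have half: "K * x powr \<theta> \<le> K * (2 powr - \<theta> * \<omega> s t powr \<theta>)" if "0 \<le> x" "x \<le> \<omega> s t / 2" for x
    proof -
      have "x powr \<theta> \<le> (\<omega> s t / 2) powr \<theta>"
        using that exponent by (intro powr_mono2) auto
      also have "\<dots> = 2 powr - \<theta> * \<omega> s t powr \<theta>"
        using control_nonneg[OF control, of s t] st less.prems
        by (simp add: powr_divide powr_minus_divide)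
      finally show ?thesis
        using K_pos by simp
    qed
    have e1: "norm (riemann k \<tau> - A s (\<tau> k)) \<le> K * (2 powr - \<theta> * \<omega> s t powr \<theta>)"
      using less.IH[OF k(1) p1] less.prems bk half[OF _ k(2)] control_nonneg[OF control, of s "\<tau> k"]
      by fastforce
    have e2: "norm (riemann m (\<lambda>i. \<tau> (i + Suc k)) - A (\<tau> (Suc k)) t)
        \<le> K * (2 powr - \<theta> * \<omega> s t powr \<theta>)"
      using less.IH[OF _ p2] less.prems bk half[OF _ right] n
        control_nonneg[OF control, of "\<tau> (Suc k)" t]
      by fastforce
    \<comment> \<open>Two defects occur: splitting \<open>[s, t]\<close> at
      \<open>\<tau> (Suc k)\<close>, and splitting its left part once more at
      \<open>\<tau> k\<close>.\<close>
    have "norm (A s (\<tau> (Suc k)) - A s (\<tau> k) - A (\<tau> k) (\<tau> (Suc k))) \<le> \<omega> s (\<tau> (Suc k)) powr \<theta>"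
      using defect[of s "\<tau> k" "\<tau> (Suc k)"] bk less.prems by simp
    also have "\<dots> \<le> \<omega> s t powr \<theta>"
      using control_mono[OF control, of s s "\<tau> (Suc k)" t] control_nonneg[OF control, of s "\<tau> (Suc k)"]
        bk less.prems exponent by (intro powr_mono2) auto
    finally have e3: "norm (A s (\<tau> (Suc k)) - A s (\<tau> k) - A (\<tau> k) (\<tau> (Suc k))) \<le> \<omega> s t powr \<theta>" .
    have e4: "norm (A s t - A s (\<tau> (Suc k)) - A (\<tau> (Suc k)) t) \<le> \<omega> s t powr \<theta>"
      using defect[of s "\<tau> (Suc k)" t] bk less.prems by simp
    have "riemann n \<tau> = riemann k \<tau> + A (\<tau> k) (\<tau> (Suc k)) + riemann m (\<lambda>i. \<tau> (i + Suc k))"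
    proof -
      have "riemann n \<tau> = riemann (Suc k) \<tau> + (\<Sum>i<m. A (\<tau> (i + Suc k)) (\<tau> (Suc (i + Suc k))))"
        unfolding n riemann_def
        by (induction m) (auto simp: algebra_simps)
      then show ?thesis
        by (simp add: riemann_def)
    qed
    then have "riemann n \<tau> - A s t = (riemann k \<tau> - A s (\<tau> k))
        + (riemann m (\<lambda>i. \<tau> (i + Suc k)) - A (\<tau> (Suc k)) t)
        - (A s (\<tau> (Suc k)) - A s (\<tau> k) - A (\<tau> k) (\<tau> (Suc k)))
        - (A s t - A s (\<tau> (Suc k)) - A (\<tau> (Suc k)) t)"
      by simp
    also have "norm \<dots> \<le> 2 * (K * (2 powr - \<theta> * \<omega> s t powr \<theta>)) + 2 * \<omega> s t powr \<theta>"
    proof -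
      have "norm (a + b - c - d) \<le> norm a + norm b + norm c + norm d" for a b c d :: 'v
        by norm
      from order_trans[OF this add_mono[OF add_mono[OF add_mono[OF e1 e2] e3] e4]] show ?thesis
        by linarith
    qed
    also have "\<dots> = (K * 2 powr (1 - \<theta>) + 2) * \<omega> s t powr \<theta>"
      by (simp add: powr_diff powr_minus_divide algebra_simps)
    finally show ?thesis
      unfolding K_eq .
  qed
qed

text \<open>Both Riemann sums are compared with the one over the common refinement, whose intervals are
  \<open>[\<tau>\<^sub>i, \<tau>\<^sub>i\<^sub>+\<^sub>1] \<inter> [\<sigma>\<^sub>j, \<sigma>\<^sub>j\<^sub>+\<^sub>1]\<close>; degenerate ones do not contribute.\<close>

lemma riemann_diff:
  assumes \<tau>: "interval_partition s t n \<tau>" and \<sigma>: "interval_partition s t m \<sigma>"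
    and "0 \<le> s" "t \<le> T"
  shows "norm (riemann n \<tau> - riemann m \<sigma>) \<le> K * (remainder n \<tau> + remainder m \<sigma>)"
proof -
  \<comment> \<open>The germ on the intersection of \<open>[a, b]\<close> and \<open>[c, d]\<close>;
    if the intervals do not overlap, both arguments coincide and \<open>A_diag\<close> gives
    0.\<close>
  define R where "R a b c d = A (clamp1 a b c) (clamp1 a b d)" for a b c d
  have one: "norm (riemann n \<tau> - (\<Sum>i<n. \<Sum>j<m. R (\<tau> i) (\<tau> (Suc i)) (\<sigma> j) (\<sigma> (Suc j))))
      \<le> K * remainder n \<tau>"
    if \<tau>: "interval_partition s t n \<tau>" and \<sigma>: "interval_partition s t m \<sigma>" for n \<tau> m \<sigma>
  proof -
    have "norm (riemann m (\<lambda>j. clamp1 (\<tau> i) (\<tau> (Suc i)) (\<sigma> j)) - A (\<tau> i) (\<tau> (Suc i)))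
        \<le> K * \<omega> (\<tau> i) (\<tau> (Suc i)) powr \<theta>" if "i < n" for i
      using that assms(3,4) interval_partition_bounds[OF \<tau>, of i]
        interval_partition_bounds[OF \<tau>, of "Suc i"] interval_partition_step[OF \<tau>, of i]
      by (intro riemann_estimate interval_partition_clamp1[OF \<sigma>]) auto
    then have "norm (A (\<tau> i) (\<tau> (Suc i)) - (\<Sum>j<m. R (\<tau> i) (\<tau> (Suc i)) (\<sigma> j) (\<sigma> (Suc j))))
        \<le> K * \<omega> (\<tau> i) (\<tau> (Suc i)) powr \<theta>" if "i < n" for i
      using that by (simp add: riemann_def R_def norm_minus_commute)
    then show ?thesis
      unfolding riemann_def remainder_def sum_subtractf[symmetric] sum_distrib_left
      by (intro sum_norm_le) auto
  qed
  \<comment> \<open>Projecting either interval onto the other yields the same intersection, or two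
    degenerate cells on which the germ vanishes.\<close>
  have swap: "R a b c d = R c d a b" if "0 \<le> a" "a \<le> b" "b \<le> T" "0 \<le> c" "c \<le> d" "d \<le> T" for a b c d
    unfolding R_def
  proof -
    consider "b \<le> c" | "d \<le> a" | "c \<le> b" "a \<le> d"
      by linarith
    then show "A (clamp1 a b c) (clamp1 a b d) = A (clamp1 c d a) (clamp1 c d b)"
    proof cases
      case 1
      then have "clamp1 a b c = b" "clamp1 a b d = b" "clamp1 c d a = c" "clamp1 c d b = c"
        using that by (auto simp: clamp1_def)
      then show ?thesis
        using A_diag[of b] A_diag[of c] that by simp
    next
      case 2
      then have "clamp1 a b c = a" "clamp1 a b d = a" "clamp1 c d a = d" "clamp1 c d b = d"
        using that by (auto simp: clamp1_def)
      then show ?thesis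
        using A_diag[of a] A_diag[of d] that by simp
    next
      case 3
      then show ?thesis
        using that by (auto simp: clamp1_def max.commute min.commute)
    qed
  qed
  have "(\<Sum>i<n. \<Sum>j<m. R (\<tau> i) (\<tau> (Suc i)) (\<sigma> j) (\<sigma> (Suc j)))
      = (\<Sum>i<n. \<Sum>j<m. R (\<sigma> j) (\<sigma> (Suc j)) (\<tau> i) (\<tau> (Suc i)))"
  proof (intro sum.cong refl swap)
    fix i j
    assume "i \<in> {..<n}" "j \<in> {..<m}"
    then show "0 \<le> \<tau> i" "\<tau> i \<le> \<tau> (Suc i)" "\<tau> (Suc i) \<le> T" "0 \<le> \<sigma> j" "\<sigma> j \<le> \<sigma> (Suc j)" "\<sigma> (Suc j) \<le> T"
      using interval_partition_bounds[OF \<tau>, of i] interval_partition_bounds[OF \<tau>, of "Suc i"]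
        interval_partition_bounds[OF \<sigma>, of j] interval_partition_bounds[OF \<sigma>, of "Suc j"]
        interval_partition_step[OF \<tau>, of i] interval_partition_step[OF \<sigma>, of j] assms(3,4)
      by auto
  qed
  also have "\<dots> = (\<Sum>j<m. \<Sum>i<n. R (\<sigma> j) (\<sigma> (Suc j)) (\<tau> i) (\<tau> (Suc i)))"
    by (rule sum.swap)
  finally have "norm (riemann n \<tau> - (\<Sum>j<m. \<Sum>i<n. R (\<sigma> j) (\<sigma> (Suc j)) (\<tau> i) (\<tau> (Suc i))))
      \<le> K * remainder n \<tau>"
    using one[OF \<tau> \<sigma>] by simp
  from norm_triangle_le_diff[OF add_mono[OF this one[OF \<sigma> \<tau>]]] show ?thesis
    by (simp add: distrib_left)
qed

text \<open>Each summand is \<open>\<omega> powr (\<theta> - 1)\<close> times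
  \<open>\<omega>\<close>: a fine mesh makes the first factor uniformly small, and superadditivity
  bounds the sum of the second by \<open>\<omega> 0 T\<close>.\<close>

lemma remainder_small:
  assumes "0 < \<epsilon>"
  obtains \<delta> where "0 < \<delta>"
    "\<And>s t n \<tau>. 0 \<le> s \<Longrightarrow> t \<le> T \<Longrightarrow> interval_partition s t n \<tau> \<Longrightarrow>
      (\<And>i. i < n \<Longrightarrow> \<tau> (Suc i) - \<tau> i < \<delta>) \<Longrightarrow> remainder n \<tau> < \<epsilon>"
proof (cases "0 \<le> T")
  case True
  \<comment> \<open>Adding 1 keeps \<open>C\<close> positive and strictly above
    \<open>\<omega> 0 T\<close>, which makes the final inequality strict.\<close>
  define C where "C = \<omega> 0 T + 1"
  have C: "0 < C"
    using control_nonneg[OF control, of 0 T] True by (simp add: C_def)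
  define \<eta> where "\<eta> = (\<epsilon> / C) powr (1 / (\<theta> - 1))"
  have \<eta>: "0 < \<eta>" "\<eta> powr (\<theta> - 1) = \<epsilon> / C"
    using assms C exponent by (simp_all add: \<eta>_def powr_powr)
  obtain \<delta> where \<delta>: "0 < \<delta>" "\<And>p q. 0 \<le> p \<Longrightarrow> p \<le> q \<Longrightarrow> q \<le> T \<Longrightarrow> q - p < \<delta> \<Longrightarrow> \<omega> p q < \<eta>"
    using small[OF \<eta>(1)] by blast
  have "remainder n \<tau> < \<epsilon>"
    if st: "0 \<le> s" "t \<le> T" and \<tau>: "interval_partition s t n \<tau>"
      and fine: "\<And>i. i < n \<Longrightarrow> \<tau> (Suc i) - \<tau> i < \<delta>" for s t n \<tau>
  proof -
    have "\<omega> (\<tau> i) (\<tau> (Suc i)) powr \<theta> \<le> \<epsilon> / C * \<omega> (\<tau> i) (\<tau> (Suc i))" if "i < n" for i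
    proof -
      have b: "0 \<le> \<tau> i" "\<tau> i \<le> \<tau> (Suc i)" "\<tau> (Suc i) \<le> T"
        using interval_partition_bounds[OF \<tau>, of i] interval_partition_bounds[OF \<tau>, of "Suc i"]
          interval_partition_step[OF \<tau>, of i] st that by auto
      define x where "x = \<omega> (\<tau> i) (\<tau> (Suc i))"
      have x: "0 \<le> x" "x \<le> \<eta>"
        using control_nonneg[OF control b] \<delta>(2)[OF b fine[OF that]] by (auto simp: x_def)
      have "x powr \<theta> = x powr (\<theta> - 1) * x"
        using x by (cases "x = 0") (auto simp: powr_diff)
      also have "\<dots> \<le> \<eta> powr (\<theta> - 1) * x"
        using x exponent by (intro mult_right_mono powr_mono2) auto
      finally show ?thesis
        by (simp add: \<eta> x_def)
    qed
    then have "remainder n \<tau> \<le> \<epsilon> / C * (\<Sum>i<n. \<omega> (\<tau> i) (\<tau> (Suc i)))"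
      unfolding remainder_def sum_distrib_left by (intro sum_mono) auto
    also have "\<dots> \<le> \<epsilon> / C * \<omega> 0 T"
      using sum_control_le[OF control \<tau> st] control_mono[OF control, of 0 s t T] st assms C
        interval_partition_bounds[OF \<tau>, of 0] by (intro mult_left_mono) auto
    also have "\<dots> < \<epsilon>"
      using C assms by (simp add: field_simps C_def)
    finally show ?thesis .
  qed
  with \<delta>(1) show ?thesis
    using that by blast
next
  case False
  \<comment> \<open>For negative \<open>T\<close> there is no admissible partition, so any mesh
    bound works.\<close>
  have "False" if "0 \<le> s" "t \<le> T" "interval_partition s t n \<tau>" for s t n \<tau>
    using that False interval_partition_bounds[OF that(3), of 0] by simp
  then show ?thesis
    using that[of 1] by (metis zero_less_one)
qed

text \<open>The values are limits of Riemann sums along refining grids: \<open>riemann_diff\<close>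
  makes the sums Cauchy because their remainders tend to 0, and \<open>riemann_estimate\<close>
  passes to the limit.\<close>

lemma sewing_exists:
  obtains F where
    "\<And>s r t. 0 \<le> s \<Longrightarrow> s \<le> r \<Longrightarrow> r \<le> t \<Longrightarrow> t \<le> T \<Longrightarrow> F s t = F s r + F r t"
    "\<And>s t. 0 \<le> s \<Longrightarrow> s \<le> t \<Longrightarrow> t \<le> T \<Longrightarrow> norm (F s t - A s t) \<le> K * \<omega> s t powr \<theta>"
proof -
  \<comment> \<open>A single grid of \<open>[0, T]\<close> is clamped to every
    \<open>[s, t]\<close>, so that the sums over \<open>[s, r]\<close>, \<open>[r, t]\<close> and
    \<open>[s, t]\<close> can be compared cell by cell.\<close>
  define \<sigma> where "\<sigma> s t n i = clamp1 s t (uniform_grid 0 T n i)" for s t n i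
  define G where "G n s t = riemann (Suc n) (\<sigma> s t n)" for n s t
  have part: "interval_partition s t (Suc n) (\<sigma> s t n)" if "0 \<le> s" "s \<le> t" "t \<le> T" for s t n
    unfolding \<sigma>_def using that by (intro interval_partition_clamp1[OF interval_partition_uniform_grid]) auto
  have rem: "(\<lambda>n. remainder (Suc n) (\<sigma> s t n)) \<longlonglongrightarrow> 0" if st: "0 \<le> s" "s \<le> t" "t \<le> T" for s t
  proof (rule tendstoI)
    fix \<epsilon> :: real
    assume "0 < \<epsilon>"
    obtain \<delta> where \<delta>: "0 < \<delta>"
      "\<And>s t n \<tau>. 0 \<le> s \<Longrightarrow> t \<le> T \<Longrightarrow> interval_partition s t n \<tau> \<Longrightarrow>
        (\<And>i. i < n \<Longrightarrow> \<tau> (Suc i) - \<tau> i < \<delta>) \<Longrightarrow> remainder n \<tau> < \<epsilon>"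
      by (rule remainder_small[OF \<open>0 < \<epsilon>\<close>]) blast
    have T: "0 \<le> T"
      using st by linarith
    show "\<forall>\<^sub>F n in sequentially. dist (remainder (Suc n) (\<sigma> s t n)) 0 < \<epsilon>"
      using uniform_grid_fine[OF T \<delta>(1)]
    proof eventually_elim
      case (elim n)
      have "\<sigma> s t n (Suc i) - \<sigma> s t n i < \<delta>" for i
        using elim[rule_format, of i] uniform_grid_step[of 0 T n i] T
          clamp1_step_le[of "uniform_grid 0 T n i" "uniform_grid 0 T n (Suc i)" s t]
          divide_nonneg_pos[of "T - 0" "real (Suc n)"]
        unfolding \<sigma>_def by linarith
      then have "remainder (Suc n) (\<sigma> s t n) < \<epsilon>"
        by (intro \<delta>(2)[OF st(1,3) part[OF st]])
      moreover have "0 \<le> remainder (Suc n) (\<sigma> s t n)"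
        by (simp add: remainder_def sum_nonneg)
      ultimately show ?case
        by simp
    qed
  qed
  have "Cauchy (\<lambda>n. G n s t)" if st: "0 \<le> s" "s \<le> t" "t \<le> T" for s t
  proof (rule CauchyI)
    fix \<epsilon> :: real
    assume "0 < \<epsilon>"
    then have "\<forall>\<^sub>F n in sequentially. remainder (Suc n) (\<sigma> s t n) < \<epsilon> / (2 * K)"
      using rem[OF st] K_pos by (intro order_tendstoD(2)[of _ 0]) auto
    then obtain N where N: "\<And>n. n \<ge> N \<Longrightarrow> remainder (Suc n) (\<sigma> s t n) < \<epsilon> / (2 * K)"
      unfolding eventually_sequentially by blast
    have "norm (G m s t - G n s t) < \<epsilon>" if "m \<ge> N" "n \<ge> N" for m n
    proof -
      have "norm (G m s t - G n s t) \<le> K * (remainder (Suc m) (\<sigma> s t m) + remainder (Suc n) (\<sigma> s t n))"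
        unfolding G_def by (intro riemann_diff[OF part[OF st] part[OF st]] st)
      also have "\<dots> < K * (\<epsilon> / (2 * K) + \<epsilon> / (2 * K))"
        using N[OF that(1)] N[OF that(2)] K_pos by (intro mult_strict_left_mono add_strict_mono)
      also have "\<dots> = \<epsilon>"
        using K_pos by (simp add: field_simps)
      finally show ?thesis .
    qed
    then show "\<exists>N. \<forall>m\<ge>N. \<forall>n\<ge>N. norm (G m s t - G n s t) < \<epsilon>"
      by blast
  qed
  then have "\<exists>L. (\<lambda>n. G n s t) \<longlonglongrightarrow> L" if "0 \<le> s" "s \<le> t" "t \<le> T" for s t
    using that by (simp flip: convergent_def Cauchy_convergent_iff)
  then obtain F where F: "\<And>s t. 0 \<le> s \<Longrightarrow> s \<le> t \<Longrightarrow> t \<le> T \<Longrightarrow> (\<lambda>n. G n s t) \<longlonglongrightarrow> F s t"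
    by metis
  show ?thesis
  proof (rule that[of F])
    fix s t
    assume st: "0 \<le> s" "s \<le> t" "t \<le> T"
    have "(\<lambda>n. norm (G n s t - A s t)) \<longlonglongrightarrow> norm (F s t - A s t)"
      by (intro tendsto_norm tendsto_diff tendsto_const F st)
    then show "norm (F s t - A s t) \<le> K * \<omega> s t powr \<theta>"
      using riemann_estimate[OF part[OF st] st(1,3)]
      by (intro Lim_bounded[where M = 0]) (auto simp: G_def)
  next
    fix s r t
    assume st: "0 \<le> s" "s \<le> r" "r \<le> t" "t \<le> T"
    \<comment> \<open>Only a cell with \<open>r\<close> inside can produce a defect; it suffices to
      bound each cell by its own term of the remainder.\<close>
    have "norm (G n s t - (G n s r + G n r t)) \<le> remainder (Suc n) (\<sigma> s t n)" for n
    proof -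
      have "norm (A (\<sigma> s t n i) (\<sigma> s t n (Suc i))
          - (A (\<sigma> s r n i) (\<sigma> s r n (Suc i)) + A (\<sigma> r t n i) (\<sigma> r t n (Suc i))))
        \<le> \<omega> (\<sigma> s t n i) (\<sigma> s t n (Suc i)) powr \<theta>" if "i < Suc n" for i
      proof -
        define x where "x = uniform_grid 0 T n i"
        define y where "y = uniform_grid 0 T n (Suc i)"
        have xy: "x \<le> y"
          using interval_partition_uniform_grid[of 0 T n] st that unfolding x_def y_def
          by (intro interval_partition_step) auto
        define a where "a = clamp1 s t x"
        define b where "b = clamp1 s t y"
        \<comment> \<open>The point of the clamped cell nearest to \<open>r\<close>. With it
          \<open>defect\<close> covers all three positions of \<open>r\<close>, one of the two
          halves being degenerate when \<open>r\<close> is outside.\<close>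
        define c where "c = clamp1 a b r"
        have ab: "0 \<le> a" "a \<le> c" "c \<le> b" "b \<le> T"
          using xy st by (auto simp: a_def b_def c_def clamp1_def)
        have "A (clamp1 s r x) (clamp1 s r y) = A a c \<and> A (clamp1 r t x) (clamp1 r t y) = A c b"
        proof -
          consider "y \<le> r" | "r \<le> x" | "x \<le> r" "r \<le> y"
            by linarith
          then show ?thesis
          proof cases
            case 1
            then have "clamp1 s r x = a" "clamp1 s r y = b" "c = b" "clamp1 r t x = r" "clamp1 r t y = r"
              using xy st by (auto simp: a_def b_def c_def clamp1_def)
            then show ?thesis
              using A_diag[of r] A_diag[of b] st ab by simp
          next
            case 2
            then have "clamp1 s r x = r" "clamp1 s r y = r" "c = a" "clamp1 r t x = a" "clamp1 r t y = b"
              using xy st by (auto simp: a_def b_def c_def clamp1_def)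
            then show ?thesis
              using A_diag[of r] A_diag[of a] st ab by simp
          next
            case 3
            then have "clamp1 s r x = a" "clamp1 s r y = r" "c = r" "clamp1 r t x = r" "clamp1 r t y = b"
              using xy st by (auto simp: a_def b_def c_def clamp1_def)
            then show ?thesis
              by simp
          qed
        qed
        note 1 = conjunct1[OF this] and 2 = conjunct2[OF this]
        show ?thesis
          using defect[OF ab] 1 2 by (simp add: \<sigma>_def x_def y_def a_def b_def algebra_simps)
      qed
      then show ?thesis
        unfolding G_def riemann_def remainder_def sum.distrib[symmetric] sum_subtractf[symmetric]
        by (intro sum_norm_le) auto
    qed
    then have "(\<lambda>n. G n s t - (G n s r + G n r t)) \<longlonglongrightarrow> 0"
      using rem[of s t] st by (intro Lim_null_comparison[OF always_eventually rem[of s t]]) auto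
    moreover have "(\<lambda>n. G n s t - (G n s r + G n r t)) \<longlonglongrightarrow> F s t - (F s r + F r t)"
      using st by (intro tendsto_diff tendsto_add F) auto
    ultimately have "0 = F s t - (F s r + F r t)"
      by (rule LIMSEQ_unique)
    then show "F s t = F s r + F r t"
      by simp
  qed
qed

end

subsection \<open>Young integrals\<close>

text \<open>Row \<open>i\<close> of the matrix is \<open>y\<close> scaled by \<open>x $ i\<close>,
  so the Hilbert-Schmidt norm factorises.\<close>

lemma norm_tensor: "norm (x \<otimes>\<^sub>v y) = norm x * norm y"
proof -
  have "(x \<otimes>\<^sub>v y) $ i = (x $ i) *\<^sub>R y" for i
    by (simp add: tensor_def vec_eq_iff)
  then have "norm (x \<otimes>\<^sub>v y) = L2_set (\<lambda>i. norm (x $ i) * norm y) UNIV"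
    by (simp only: norm_vec_def[of "x \<otimes>\<^sub>v y"] norm_scaleR real_norm_def)
  then show ?thesis
    by (simp add: L2_set_left_distrib norm_vec_def[of x])
qed

lemma tensor_add_left: "(x + y) \<otimes>\<^sub>v z = x \<otimes>\<^sub>v z + y \<otimes>\<^sub>v z"
  and tensor_add_right: "z \<otimes>\<^sub>v (x + y) = z \<otimes>\<^sub>v x + z \<otimes>\<^sub>v y"
  and tensor_diff_left: "(x - y) \<otimes>\<^sub>v z = x \<otimes>\<^sub>v z - y \<otimes>\<^sub>v z"
  and tensor_diff_right: "z \<otimes>\<^sub>v (x - y) = z \<otimes>\<^sub>v x - z \<otimes>\<^sub>v y"
  and tensor_zero_right: "z \<otimes>\<^sub>v 0 = 0"
  by (simp_all add: tensor_def vec_eq_iff algebra_simps)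

lemma tensor_sum_right: "x \<otimes>\<^sub>v (\<Sum>i\<in>I. z i) = (\<Sum>i\<in>I. x \<otimes>\<^sub>v z i)"
  by (induction I rule: infinite_finite_induct) (simp_all add: tensor_zero_right tensor_add_right)

lemma additive_sum:
  fixes F :: "real \<Rightarrow> real \<Rightarrow> 'v :: ab_group_add"
  assumes F: "\<And>s r t. 0 \<le> s \<Longrightarrow> s \<le> r \<Longrightarrow> r \<le> t \<Longrightarrow> t \<le> T \<Longrightarrow> F s t = F s r + F r t"
    and \<tau>: "interval_partition s t n \<tau>" and "0 \<le> s" "t \<le> T"
  shows "(\<Sum>i<n. F (\<tau> i) (\<tau> (Suc i))) = F s t"
proof -
  have "(\<Sum>i<k. F (\<tau> i) (\<tau> (Suc i))) = F s (\<tau> k)" if "k \<le> n" for k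
    using that
  proof (induction k)
    case 0
    have "F s s = F s s + F s s"
      using F[of s s s] interval_partition_bounds[OF \<tau>, of 0] assms by simp
    then show ?case
      using \<tau> by (simp add: interval_partition_def)
  next
    case (Suc k)
    then show ?case
      using F[of s "\<tau> k" "\<tau> (Suc k)"] interval_partition_bounds[OF \<tau>, of k]
        interval_partition_bounds[OF \<tau>, of "Suc k"] interval_partition_step[OF \<tau>, of k] assms(3,4)
      by simp
  qed
  from this[of n] show ?thesis
    using \<tau> by (simp add: interval_partition_def)
qed

text \<open>Sewing of the left-point germ \<open>incr x 0 p \<otimes>\<^sub>v incr z p q\<close>,
  whose defect is minus \<open>incr x p r \<otimes>\<^sub>v incr z r q\<close>. The bound has
  independent \<open>r\<close> and \<open>r'\<close>: the choice \<open>r' = r\<close> serves the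
  defect, the choice \<open>r' = p\<close> the passage from left endpoints to arbitrary
  tags.\<close>

lemma young_integral_exists:
  fixes x :: "real \<Rightarrow> real ^ 'm" and z :: "real \<Rightarrow> real ^ 'n"
  assumes control: "control T \<omega>" and exponent: "1 < \<theta>"
    and small: "\<And>\<epsilon>. 0 < \<epsilon> \<Longrightarrow> \<exists>\<delta>>0. \<forall>p q. 0 \<le> p \<and> p \<le> q \<and> q \<le> T \<and> q - p < \<delta> \<longrightarrow> \<omega> p q < \<epsilon>"
    and bound: "\<And>p r r' q. 0 \<le> p \<Longrightarrow> p \<le> r \<Longrightarrow> r \<le> q \<Longrightarrow> p \<le> r' \<Longrightarrow> r' \<le> q \<Longrightarrow> q \<le> T \<Longrightarrow>
      norm (incr x p r) * norm (incr z r' q) \<le> \<omega> p q powr \<theta>"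
  obtains J C where
    "\<And>s t. 0 \<le> s \<Longrightarrow> s \<le> t \<Longrightarrow> t \<le> T \<Longrightarrow> has_young_integral x z s t (J s t)"
    "\<And>s t. 0 \<le> s \<Longrightarrow> s \<le> t \<Longrightarrow> t \<le> T \<Longrightarrow> norm (J s t) \<le> C * \<omega> s t powr \<theta>"
    "\<And>s r t. 0 \<le> s \<Longrightarrow> s \<le> r \<Longrightarrow> r \<le> t \<Longrightarrow> t \<le> T \<Longrightarrow>
      J s t = J s r + J r t + incr x s r \<otimes>\<^sub>v incr z r t"
    "0 < C"
proof -
  define A where "A p q = incr x 0 p \<otimes>\<^sub>v incr z p q" for p q
  interpret sewing T \<theta> \<omega> A
  proof
    fix p r q
    assume pq: "0 \<le> p" "p \<le> r" "r \<le> q" "q \<le> T"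
    have "A p q - A p r - A r q = - (incr x p r \<otimes>\<^sub>v incr z r q)"
      by (simp add: A_def incr_def tensor_diff_left tensor_diff_right)
    then show "norm (A p q - A p r - A r q) \<le> \<omega> p q powr \<theta>"
      using bound[of p r q r] pq by (simp add: norm_tensor)
  qed (use control exponent small in auto)
  obtain F where F: "\<And>s r t. 0 \<le> s \<Longrightarrow> s \<le> r \<Longrightarrow> r \<le> t \<Longrightarrow> t \<le> T \<Longrightarrow> F s t = F s r + F r t"
    "\<And>s t. 0 \<le> s \<Longrightarrow> s \<le> t \<Longrightarrow> t \<le> T \<Longrightarrow> norm (F s t - A s t) \<le> K * \<omega> s t powr \<theta>"
    by (rule sewing_exists) blast
  \<comment> \<open>Subtracting \<open>A s t\<close> moves the base point of the integrand from 0 to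
    \<open>s\<close>.\<close>
  define J where "J s t = F s t - A s t" for s t
  show ?thesis
  proof (rule that[of J K])
    fix s t
    assume st: "0 \<le> s" "s \<le> t" "t \<le> T"
    show "has_young_integral x z s t (J s t)"
      unfolding has_young_integral_def
    proof (intro allI impI)
      fix \<epsilon> :: real
      assume "0 < \<epsilon>"
      \<comment> \<open>The share \<open>K\<close> pays for the sewing error and the share 1 for
        moving the tags.\<close>
      then have "0 < \<epsilon> / (K + 1)"
        using K_pos by simp
      then obtain \<delta> where \<delta>: "0 < \<delta>"
        "\<And>s t n \<tau>. 0 \<le> s \<Longrightarrow> t \<le> T \<Longrightarrow> interval_partition s t n \<tau> \<Longrightarrow>
          (\<And>i. i < n \<Longrightarrow> \<tau> (Suc i) - \<tau> i < \<delta>) \<Longrightarrow> remainder n \<tau> < \<epsilon> / (K + 1)"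
        by (rule remainder_small) blast
      have "norm ((\<Sum>i<n. incr x s (\<xi> i) \<otimes>\<^sub>v incr z (\<tau> i) (\<tau> (Suc i))) - J s t) < \<epsilon>"
        if \<tau>: "interval_partition s t n \<tau>"
          and fine: "\<And>i. i < n \<Longrightarrow> \<tau> (Suc i) - \<tau> i < \<delta> \<and> \<tau> i \<le> \<xi> i \<and> \<xi> i \<le> \<tau> (Suc i)" for n \<tau> \<xi>
      proof -
        let ?z = "\<lambda>i. incr z (\<tau> i) (\<tau> (Suc i))"
        have b: "0 \<le> \<tau> i" "\<tau> i \<le> \<tau> (Suc i)" "\<tau> (Suc i) \<le> T" if "i < n" for i
          using interval_partition_bounds[OF \<tau>, of i] interval_partition_bounds[OF \<tau>, of "Suc i"]
            interval_partition_step[OF \<tau>, of i] st that by auto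
        have z: "(\<Sum>i<n. ?z i) = incr z s t"
          by (rule additive_sum[OF _ \<tau> st(1,3)]) (simp add: incr_def)
        have "incr x s (\<xi> i) \<otimes>\<^sub>v ?z i
            = A (\<tau> i) (\<tau> (Suc i)) + incr x (\<tau> i) (\<xi> i) \<otimes>\<^sub>v ?z i - incr x 0 s \<otimes>\<^sub>v ?z i" for i
          unfolding A_def incr_def[of x] by (simp add: tensor_diff_left)
        then have "(\<Sum>i<n. incr x s (\<xi> i) \<otimes>\<^sub>v ?z i) - J s t
            = (\<Sum>i<n. A (\<tau> i) (\<tau> (Suc i))) + (\<Sum>i<n. incr x (\<tau> i) (\<xi> i) \<otimes>\<^sub>v ?z i)
              - incr x 0 s \<otimes>\<^sub>v (\<Sum>i<n. ?z i) - J s t"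
          by (simp add: sum.distrib sum_subtractf tensor_sum_right)
        also have "\<dots> = (\<Sum>i<n. A (\<tau> i) (\<tau> (Suc i)) - F (\<tau> i) (\<tau> (Suc i)))
            + (\<Sum>i<n. incr x (\<tau> i) (\<xi> i) \<otimes>\<^sub>v ?z i)"
          using additive_sum[of T F, OF F(1) \<tau> st(1,3)]
          by (simp add: z J_def A_def sum_subtractf)
        also have "norm \<dots> \<le> K * remainder n \<tau> + remainder n \<tau>"
        proof (rule norm_triangle_mono)
          show "norm (\<Sum>i<n. A (\<tau> i) (\<tau> (Suc i)) - F (\<tau> i) (\<tau> (Suc i))) \<le> K * remainder n \<tau>"
            unfolding remainder_def sum_distrib_left
            using F(2) b by (intro sum_norm_le) (auto simp: norm_minus_commute)
          show "norm (\<Sum>i<n. incr x (\<tau> i) (\<xi> i) \<otimes>\<^sub>v ?z i) \<le> remainder n \<tau>"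
            unfolding remainder_def
            using bound b fine by (intro sum_norm_le) (auto simp: norm_tensor)
        qed
        also have "\<dots> = (K + 1) * remainder n \<tau>"
          by (simp add: algebra_simps)
        also have "\<dots> < \<epsilon>"
          using \<delta>(2)[OF st(1,3) \<tau>] fine K_pos by (simp add: field_simps)
        finally show ?thesis .
      qed
      then show "\<exists>\<delta>>0. \<forall>n \<tau> \<xi>. interval_partition s t n \<tau> \<and>
          (\<forall>i<n. \<tau> (Suc i) - \<tau> i < \<delta> \<and> \<tau> i \<le> \<xi> i \<and> \<xi> i \<le> \<tau> (Suc i)) \<longrightarrow>
          norm ((\<Sum>i<n. incr x s (\<xi> i) \<otimes>\<^sub>v incr z (\<tau> i) (\<tau> (Suc i))) - J s t) < \<epsilon>"
        using \<delta>(1) by blast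
    qed
    show "norm (J s t) \<le> K * \<omega> s t powr \<theta>"
      unfolding J_def by (rule F(2)[OF st])
  next
    fix s r t
    assume "0 \<le> s" "s \<le> r" "r \<le> t" "t \<le> T"
    then have "F s t = F s r + F r t"
      by (rule F(1))
    then show "J s t = J s r + J r t + incr x s r \<otimes>\<^sub>v incr z r t"
      by (simp add: J_def A_def incr_def tensor_diff_left tensor_diff_right)
  qed (rule K_pos)
qed

text \<open>Both values lie within half their distance of one and the same Riemann sum, taken over a
  fine uniform grid with its left endpoints as tags.\<close>

lemma has_young_integral_unique:
  assumes "has_young_integral x z s t J" "has_young_integral x z s t J'" "s \<le> t"
  shows "J = J'"
proof (rule ccontr)
  assume "J \<noteq> J'"
  define \<epsilon> where "\<epsilon> = norm (J - J') / 2"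
  have "0 < \<epsilon>"
    using \<open>J \<noteq> J'\<close> by (simp add: \<epsilon>_def)
  let ?S = "\<lambda>n \<tau> \<xi>. \<Sum>i<n. incr x s (\<xi> i) \<otimes>\<^sub>v incr z (\<tau> i) (\<tau> (Suc i))"
  obtain \<delta> where \<delta>: "0 < \<delta>" "\<forall>n \<tau> \<xi>. interval_partition s t n \<tau> \<and>
      (\<forall>i<n. \<tau> (Suc i) - \<tau> i < \<delta> \<and> \<tau> i \<le> \<xi> i \<and> \<xi> i \<le> \<tau> (Suc i)) \<longrightarrow> norm (?S n \<tau> \<xi> - J) < \<epsilon>"
    using assms(1)[unfolded has_young_integral_def, rule_format, OF \<open>0 < \<epsilon>\<close>] by (elim exE conjE)
  obtain \<delta>' where \<delta>': "0 < \<delta>'" "\<forall>n \<tau> \<xi>. interval_partition s t n \<tau> \<and>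
      (\<forall>i<n. \<tau> (Suc i) - \<tau> i < \<delta>' \<and> \<tau> i \<le> \<xi> i \<and> \<xi> i \<le> \<tau> (Suc i)) \<longrightarrow> norm (?S n \<tau> \<xi> - J') < \<epsilon>"
    using assms(2)[unfolded has_young_integral_def, rule_format, OF \<open>0 < \<epsilon>\<close>] by (elim exE conjE)
  have "0 < min \<delta> \<delta>'"
    using \<delta> \<delta>' by simp
  from eventually_happens[OF uniform_grid_fine[OF assms(3) this]]
  obtain n where n: "\<forall>i. uniform_grid s t n (Suc i) - uniform_grid s t n i < min \<delta> \<delta>'"
    by (auto simp del: min_less_iff_conj)
  note part = interval_partition_uniform_grid[OF assms(3), of n]
  let ?g = "uniform_grid s t n"
  have "norm (?S (Suc n) ?g ?g - J) < \<epsilon>"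
    using n interval_partition_step[OF part] by (intro \<delta>(2)[rule_format]) (simp add: part)
  moreover have "norm (?S (Suc n) ?g ?g - J') < \<epsilon>"
    using n interval_partition_step[OF part] by (intro \<delta>'(2)[rule_format]) (simp add: part)
  ultimately have "norm ((?S (Suc n) ?g ?g - J') - (?S (Suc n) ?g ?g - J)) < \<epsilon> + \<epsilon>"
    by (intro order_le_less_trans[OF norm_triangle_ineq4]) linarith
  then have "norm (J - J') < \<epsilon> + \<epsilon>"
    by simp
  then show False
    by (simp add: \<epsilon>_def)
qed

lemma young_integral_eqI: "has_young_integral x z s t J \<Longrightarrow> s \<le> t \<Longrightarrow> young_integral x z s t = J"
  unfolding young_integral_def using has_young_integral_unique by blast


subsection \<open>Hoelder paths and paths of Cameron--Martin type\<close>

definition hoelder :: "real \<Rightarrow> real \<Rightarrow> (real \<Rightarrow> 'v :: real_normed_vector) \<Rightarrow> bool"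
  where "hoelder T \<alpha> x \<longleftrightarrow>
      (\<exists>C\<ge>0. \<forall>s t. 0 \<le> s \<and> s \<le> t \<and> t \<le> T \<longrightarrow> norm (incr x s t) \<le> C * (t - s) powr \<alpha>)"

text \<open>For \<open>H = 1 / 2\<close> and a path with square integrable derivative this is the
  Cauchy-Schwarz inequality, with \<open>E s t\<close> the integral of the squared derivative over
  \<open>[s, t]\<close>.\<close>

definition cm_regular :: "real \<Rightarrow> real \<Rightarrow> (real \<Rightarrow> 'v :: real_normed_vector) \<Rightarrow> bool"
  where "cm_regular T H h \<longleftrightarrow>
      (\<exists>E. control T E \<and>
        (\<forall>s t. 0 \<le> s \<and> s \<le> t \<and> t \<le> T \<longrightarrow> (norm (incr h s t))\<^sup>2 \<le> E s t * (t - s) powr (2 * H)))"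

lemma powr_le_powr_smaller:
  fixes x :: real
  assumes "0 \<le> x" "x \<le> T" "a \<le> b"
  shows "x powr b \<le> T powr (b - a) * x powr a"
proof -
  have "x powr b = x powr (b - a) * x powr a"
    by (simp flip: powr_add)
  also have "\<dots> \<le> T powr (b - a) * x powr a"
    using assms by (intro mult_right_mono powr_mono2) auto
  finally show ?thesis .
qed

text \<open>Hoelder's inequality for sums of two terms: Young's inequality is applied to the ratios
  with the totals \<open>a + b\<close> and \<open>c + d\<close>, and the normalised right-hand sides
  add up to \<open>\<alpha> + \<beta> = 1\<close>.\<close>

lemma powr_mult_superadditive:
  fixes a b c d :: real
  assumes "0 \<le> a" "0 \<le> b" "0 \<le> c" "0 \<le> d" and \<alpha>: "0 < \<alpha>" "0 < \<beta>" "\<alpha> + \<beta> = 1"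
  shows "a powr \<alpha> * c powr \<beta> + b powr \<alpha> * d powr \<beta> \<le> (a + b) powr \<alpha> * (c + d) powr \<beta>"
proof (cases "a + b = 0 \<or> c + d = 0")
  case True
  then have "(a = 0 \<and> b = 0) \<or> (c = 0 \<and> d = 0)"
    using assms by linarith
  then show ?thesis
    by auto
next
  case False
  then have pos: "0 < a + b" "0 < c + d"
    using assms by linarith+
  have young: "x powr \<alpha> * y powr \<beta> \<le> (a + b) powr \<alpha> * (c + d) powr \<beta> * (\<alpha> * (x / (a + b)) + \<beta> * (y / (c + d)))"
    if "0 \<le> x" "0 \<le> y" for x y
  proof (cases "x = 0 \<or> y = 0")
    case True
    then show ?thesis
      using that pos \<alpha> by auto
  next
    case False
    then have "(x / (a + b)) powr \<alpha> * (y / (c + d)) powr \<beta> \<le> \<alpha> * (x / (a + b)) + \<beta> * (y / (c + d))"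
      using that pos \<alpha> by (intro Youngs_inequality_0) auto
    then show ?thesis
      using that pos by (simp add: powr_divide field_simps)
  qed
  have "a powr \<alpha> * c powr \<beta> + b powr \<alpha> * d powr \<beta>
      \<le> (a + b) powr \<alpha> * (c + d) powr \<beta> *
        (\<alpha> * (a / (a + b) + b / (a + b)) + \<beta> * (c / (c + d) + d / (c + d)))"
    using add_mono[OF young[of a c] young[of b d]] assms by (simp add: algebra_simps)
  also have "\<dots> = (a + b) powr \<alpha> * (c + d) powr \<beta>"
    using pos \<alpha> by (simp flip: add_divide_distrib)
  finally show ?thesis .
qed

text \<open>A weighted geometric mean of the controls \<open>t - s\<close> and \<open>E s t\<close>
  is again a control.\<close>

lemma control_powr_mult:
  assumes "control T E" "0 < \<alpha>" "0 < \<beta>" "\<alpha> + \<beta> = 1" "0 \<le> C"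
  shows "control T (\<lambda>s t. C * ((t - s) powr \<alpha> * E s t powr \<beta>))"
  unfolding control_def
proof (intro conjI allI impI)
  fix s t
  show "0 \<le> C * ((t - s) powr \<alpha> * E s t powr \<beta>)"
    using assms by simp
next
  fix s r t
  assume st: "0 \<le> s \<and> s \<le> r \<and> r \<le> t \<and> t \<le> T"
  have "(r - s) powr \<alpha> * E s r powr \<beta> + (t - r) powr \<alpha> * E r t powr \<beta>
      \<le> ((r - s) + (t - r)) powr \<alpha> * (E s r + E r t) powr \<beta>"
    using st control_nonneg[OF assms(1)] assms by (intro powr_mult_superadditive) auto
  also have "\<dots> \<le> (t - s) powr \<alpha> * E s t powr \<beta>"
    using st control_nonneg[OF assms(1)] control_superadditive[OF assms(1), of s r t] assms
    by (auto intro!: mult_left_mono powr_mono2)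
  finally show "C * ((r - s) powr \<alpha> * E s r powr \<beta>) + C * ((t - r) powr \<alpha> * E r t powr \<beta>)
      \<le> C * ((t - s) powr \<alpha> * E s t powr \<beta>)"
    using assms(5) by (simp add: mult_left_mono flip: distrib_left)
qed

lemma hoelder_continuous_on:
  assumes "hoelder T \<alpha> x" "0 < \<alpha>"
  shows "continuous_on {0..T} x"
proof -
  obtain C where C: "0 \<le> C" "\<And>s t. 0 \<le> s \<Longrightarrow> s \<le> t \<Longrightarrow> t \<le> T \<Longrightarrow> norm (incr x s t) \<le> C * (t - s) powr \<alpha>"
    using assms(1) unfolding hoelder_def by blast
  have le: "dist (x t) (x s) \<le> C * \<bar>t - s\<bar> powr \<alpha>" if "s \<in> {0..T}" "t \<in> {0..T}" for s t
    using C(2)[of s t] C(2)[of t s] that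
    by (cases "s \<le> t") (auto simp: dist_norm incr_def norm_minus_commute)
  show ?thesis
    unfolding continuous_on
  proof
    fix s
    assume s: "s \<in> {0..T}"
    have "((\<lambda>t. C * \<bar>t - s\<bar> powr \<alpha>) \<longlongrightarrow> C * \<bar>s - s\<bar> powr \<alpha>) (at s within {0..T})"
      using assms(2)
      by (intro tendsto_mult_left tendsto_powr' tendsto_const tendsto_rabs tendsto_diff tendsto_ident_at)
        auto
    then have lim: "((\<lambda>t. C * \<bar>t - s\<bar> powr \<alpha>) \<longlongrightarrow> 0) (at s within {0..T})"
      using assms(2) by simp
    have "\<forall>\<^sub>F t in at s within {0..T}. dist (x t) (x s) \<le> dist (C * \<bar>t - s\<bar> powr \<alpha>) 0"
      unfolding eventually_at_filter
      by (rule always_eventually) (use le[OF s] C(1) in simp)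
    then show "(x \<longlongrightarrow> x s) (at s within {0..T})"
      by (rule metric_tendsto_imp_tendsto[OF lim])
  qed
qed

lemma finite_variation_control:
  assumes "control T \<omega>" "\<And>s t. 0 \<le> s \<Longrightarrow> s \<le> t \<Longrightarrow> t \<le> T \<Longrightarrow> norm (incr x s t) powr p \<le> \<omega> s t"
  shows "finite_variation p 0 T x"
  unfolding finite_variation_def
proof (rule bdd_aboveI)
  fix y
  assume "y \<in> {\<Sum>i<n. norm (x (\<tau> (Suc i)) - x (\<tau> i)) powr p | n \<tau>. interval_partition 0 T n \<tau>}"
  then obtain n \<tau> where y: "y = (\<Sum>i<n. norm (x (\<tau> (Suc i)) - x (\<tau> i)) powr p)"
    and \<tau>: "interval_partition 0 T n \<tau>"
    by blast
  have "y \<le> (\<Sum>i<n. \<omega> (\<tau> i) (\<tau> (Suc i)))"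
    unfolding y
    using interval_partition_bounds[OF \<tau>] interval_partition_step[OF \<tau>]
    by (intro sum_mono) (auto intro!: assms(2)[unfolded incr_def])
  also have "\<dots> \<le> \<omega> 0 T"
    by (rule sum_control_le[OF assms(1) \<tau>]) auto
  finally show "y \<le> \<omega> 0 T" .
qed

lemma hoelder_finite_variation:
  assumes "hoelder T \<alpha> x" "0 < \<alpha>"
  shows "finite_variation (1 / \<alpha>) 0 T x"
proof -
  obtain C where C: "0 \<le> C" "\<And>s t. 0 \<le> s \<Longrightarrow> s \<le> t \<Longrightarrow> t \<le> T \<Longrightarrow> norm (incr x s t) \<le> C * (t - s) powr \<alpha>"
    using assms(1) unfolding hoelder_def by blast
  have "norm (incr x s t) powr (1 / \<alpha>) \<le> C powr (1 / \<alpha>) * (t - s)" if "0 \<le> s" "s \<le> t" "t \<le> T" for s t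
  proof -
    have "norm (incr x s t) powr (1 / \<alpha>) \<le> (C * (t - s) powr \<alpha>) powr (1 / \<alpha>)"
      using C(2)[OF that] assms(2) by (intro powr_mono2) auto
    also have "\<dots> = C powr (1 / \<alpha>) * (t - s)"
      using C(1) assms(2) that by (simp add: powr_mult powr_powr)
    finally show ?thesis .
  qed
  moreover have "control T (\<lambda>s t. C powr (1 / \<alpha>) * (t - s))"
    by (auto simp: control_def simp flip: distrib_left)
  ultimately show ?thesis
    by (rule finite_variation_control[rotated])
qed

text \<open>The square root of the defining estimate, ready to be multiplied by a Hoelder
  bound.\<close>

lemma cm_regularE:
  assumes "cm_regular T H h"
  obtains E where "control T E"
    "\<And>s t. 0 \<le> s \<Longrightarrow> s \<le> t \<Longrightarrow> t \<le> T \<Longrightarrow> norm (incr h s t) \<le> (t - s) powr H * E s t powr (1 / 2)"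
proof -
  obtain E where E: "control T E"
    "\<And>s t. 0 \<le> s \<Longrightarrow> s \<le> t \<Longrightarrow> t \<le> T \<Longrightarrow> (norm (incr h s t))\<^sup>2 \<le> E s t * (t - s) powr (2 * H)"
    using assms unfolding cm_regular_def by blast
  have "norm (incr h s t) \<le> (t - s) powr H * E s t powr (1 / 2)" if "0 \<le> s" "s \<le> t" "t \<le> T" for s t
  proof -
    have "norm (incr h s t) \<le> sqrt (E s t * (t - s) powr (2 * H))"
      using E(2)[OF that] by (rule real_le_rsqrt)
    also have "\<dots> = (E s t * (t - s) powr (2 * H)) powr (1 / 2)"
      using control_nonneg[OF E(1) that] by (simp add: powr_half_sqrt)
    also have "\<dots> = (t - s) powr H * E s t powr (1 / 2)"
      using control_nonneg[OF E(1) that] that by (simp add: powr_mult powr_powr)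
    finally show ?thesis .
  qed
  with E(1) show ?thesis
    by (rule that)
qed

text \<open>Replacing \<open>E s t\<close> by \<open>E 0 T\<close> leaves the exponent
  \<open>H\<close>, whose surplus \<open>H - \<alpha>\<close> turns into a power of
  \<open>T\<close>.\<close>

lemma cm_regular_hoelder:
  assumes "cm_regular T H h" "\<alpha> \<le> H"
  shows "hoelder T \<alpha> h"
proof -
  obtain E where E: "control T E"
    "\<And>s t. 0 \<le> s \<Longrightarrow> s \<le> t \<Longrightarrow> t \<le> T \<Longrightarrow> norm (incr h s t) \<le> (t - s) powr H * E s t powr (1 / 2)"
    using cm_regularE[OF assms(1)] by blast
  have "norm (incr h s t) \<le> (T powr (H - \<alpha>) * E 0 T powr (1 / 2)) * (t - s) powr \<alpha>"
    if st: "0 \<le> s" "s \<le> t" "t \<le> T" for s t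
  proof -
    have "norm (incr h s t) \<le> (t - s) powr H * E s t powr (1 / 2)"
      by (rule E(2)[OF st])
    also have "\<dots> \<le> (T powr (H - \<alpha>) * (t - s) powr \<alpha>) * E 0 T powr (1 / 2)"
      using powr_le_powr_smaller[of "t - s" T \<alpha> H] assms(2) st
        control_mono[OF E(1), of 0 s t T] control_nonneg[OF E(1) st]
      by (intro mult_mono powr_mono2) auto
    finally show ?thesis
      by (simp add: mult_ac)
  qed
  then show ?thesis
    unfolding hoelder_def by (intro exI[of _ "T powr (H - \<alpha>) * E 0 T powr (1 / 2)"]) auto
qed

text \<open>The exponent \<open>q\<close> solves \<open>H * q + q / 2 = 1\<close>, so the
  \<open>q\<close>-th power of an increment is dominated by a weighted geometric mean of
  \<open>t - s\<close> and \<open>E s t\<close>, a control.\<close>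

lemma cm_regular_finite_variation:
  assumes "cm_regular T H h" "0 < H"
  shows "finite_variation (1 / (H + 1 / 2)) 0 T h"
proof -
  let ?q = "1 / (H + 1 / 2)"
  obtain E where E: "control T E"
    "\<And>s t. 0 \<le> s \<Longrightarrow> s \<le> t \<Longrightarrow> t \<le> T \<Longrightarrow> norm (incr h s t) \<le> (t - s) powr H * E s t powr (1 / 2)"
    using cm_regularE[OF assms(1)] by blast
  have "norm (incr h s t) powr ?q \<le> 1 * ((t - s) powr (H * ?q) * E s t powr (1 / 2 * ?q))"
    if "0 \<le> s" "s \<le> t" "t \<le> T" for s t
  proof -
    have "norm (incr h s t) powr ?q \<le> ((t - s) powr H * E s t powr (1 / 2)) powr ?q"
      using E(2)[OF that] assms(2) by (intro powr_mono2) auto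
    then show ?thesis
      by (simp add: powr_mult powr_powr)
  qed
  moreover have "control T (\<lambda>s t. 1 * ((t - s) powr (H * ?q) * E s t powr (1 / 2 * ?q)))"
    using assms(2) by (intro control_powr_mult E(1)) (auto simp: divide_simps)
  ultimately show ?thesis
    by (rule finite_variation_control[rotated])
qed

section \<open>Young integrals between Hoelder and Cameron-Martin paths\<close>

definition young_pair :: "real \<Rightarrow> real \<Rightarrow> (real \<Rightarrow> real ^ 'm) \<Rightarrow> (real \<Rightarrow> real ^ 'n) \<Rightarrow> bool"
  where "young_pair T \<alpha> x z \<longleftrightarrow> young_integrable T x z \<and>
      (\<exists>C\<ge>0. \<forall>s t. 0 \<le> s \<and> s \<le> t \<and> t \<le> T \<longrightarrow>
        norm (young_integral x z s t) \<le> C * (t - s) powr (2 * \<alpha>)) \<and>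
      (\<forall>s r t. 0 \<le> s \<and> s \<le> r \<and> r \<le> t \<and> t \<le> T \<longrightarrow>
        young_integral x z s t = young_integral x z s r + young_integral x z r t + incr x s r \<otimes>\<^sub>v incr z r t)"

text \<open>The domination concerns only the product of the two increments, so either path may be
  the integrator. The dominating function is the \<open>\<theta>\<close>-th power of a control with
  \<open>\<theta> = \<alpha> + H + 1 / 2\<close>.\<close>

lemma young_pair_if_dominated:
  fixes x :: "real \<Rightarrow> real ^ 'm" and z :: "real \<Rightarrow> real ^ 'n"
  assumes "control T E" "0 \<le> C" "0 < \<alpha>" "\<alpha> \<le> H" "1 / 2 < \<alpha> + H"
    and bound: "\<And>p r r' q. 0 \<le> p \<Longrightarrow> p \<le> r \<Longrightarrow> r \<le> q \<Longrightarrow> p \<le> r' \<Longrightarrow> r' \<le> q \<Longrightarrow> q \<le> T \<Longrightarrow>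
      norm (incr x p r) * norm (incr z r' q) \<le> C * ((q - p) powr (\<alpha> + H) * E p q powr (1 / 2))"
    and reg: "continuous_on {0..T} x" "continuous_on {0..T} z"
      "\<exists>p\<ge>1. \<exists>q\<ge>1. 1 / p + 1 / q > 1 \<and> finite_variation p 0 T x \<and> finite_variation q 0 T z"
  shows "young_pair T \<alpha> x z"
proof -
  define \<theta> where "\<theta> = \<alpha> + H + 1 / 2"
  have \<theta>: "1 < \<theta>"
    using assms by (simp add: \<theta>_def)
  \<comment> \<open>Dividing the exponents by \<open>\<theta>\<close> makes them add up to 1, the
    form \<open>control_powr_mult\<close> asks for.\<close>
  define a where "a = (\<alpha> + H) / \<theta>"
  define e where "e = 1 / 2 / \<theta>"
  have ae: "0 < a" "0 < e" "a + e = 1" "a * \<theta> = \<alpha> + H" "e * \<theta> = 1 / 2"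
    using \<theta> assms by (auto simp: a_def e_def \<theta>_def divide_simps)
  define D where "D = C powr (1 / \<theta>)"
  define \<omega> where "\<omega> s t = D * ((t - s) powr a * E s t powr e)" for s t
  have \<omega>: "control T \<omega>"
    unfolding \<omega>_def by (intro control_powr_mult assms ae) (simp add: D_def)
  have \<omega>_powr: "\<omega> s t powr \<theta> = C * ((t - s) powr (\<alpha> + H) * E s t powr (1 / 2))" for s t
  proof -
    have "D powr \<theta> = C"
      using \<theta> assms(2) by (simp add: D_def powr_powr)
    then show ?thesis
      by (simp only: \<omega>_def powr_mult powr_powr ae)
  qed
  have small: "\<exists>\<delta>>0. \<forall>p q. 0 \<le> p \<and> p \<le> q \<and> q \<le> T \<and> q - p < \<delta> \<longrightarrow> \<omega> p q < \<epsilon>" if "0 < \<epsilon>" for \<epsilon>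
  proof -
    \<comment> \<open>Smallness comes from the factor \<open>(q - p) powr a\<close> alone, with
      \<open>E p q\<close> bounded by \<open>E 0 T\<close>; the added 1 makes the comparison
      strict.\<close>
    define B where "B = D * E 0 T powr e + 1"
    have B: "0 < B"
      by (simp add: B_def D_def add_nonneg_pos)
    define \<delta> where "\<delta> = (\<epsilon> / B) powr (1 / a)"
    have \<delta>: "0 < \<delta>" "\<delta> powr a = \<epsilon> / B"
      using that B ae by (simp_all add: \<delta>_def powr_powr)
    have "\<omega> p q < \<epsilon>" if pq: "0 \<le> p" "p \<le> q" "q \<le> T" "q - p < \<delta>" for p q
    proof -
      have "\<omega> p q \<le> D * ((\<epsilon> / B) * E 0 T powr e)"
        unfolding \<omega>_def \<delta>(2)[symmetric]
        using pq ae control_nonneg[OF assms(1) pq(1-3)] control_mono[OF assms(1), of 0 p q T]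
        by (intro mult_left_mono mult_mono powr_mono2) (auto simp: D_def)
      also have "\<dots> = \<epsilon> * ((B - 1) / B)"
        by (simp add: B_def)
      also have "\<dots> < \<epsilon>"
        using B \<open>0 < \<epsilon>\<close> by (simp add: field_simps)
      finally show ?thesis .
    qed
    then show ?thesis
      using \<delta>(1) by blast
  qed
  obtain J K where J:
    "\<And>s t. 0 \<le> s \<Longrightarrow> s \<le> t \<Longrightarrow> t \<le> T \<Longrightarrow> has_young_integral x z s t (J s t)"
    "\<And>s t. 0 \<le> s \<Longrightarrow> s \<le> t \<Longrightarrow> t \<le> T \<Longrightarrow> norm (J s t) \<le> K * \<omega> s t powr \<theta>"
    "\<And>s r t. 0 \<le> s \<Longrightarrow> s \<le> r \<Longrightarrow> r \<le> t \<Longrightarrow> t \<le> T \<Longrightarrow>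
      J s t = J s r + J r t + incr x s r \<otimes>\<^sub>v incr z r t"
    "0 < K"
    by (rule young_integral_exists[OF \<omega> \<theta> small bound[folded \<omega>_powr]]) blast+
  have eq: "young_integral x z s t = J s t" if "0 \<le> s" "s \<le> t" "t \<le> T" for s t
    using J(1)[OF that] that(2) by (rule young_integral_eqI)
  \<comment> \<open>The surplus \<open>H - \<alpha>\<close> of \<open>\<alpha> + H\<close> over
    \<open>2 * \<alpha>\<close> becomes a power of \<open>T\<close>, and \<open>E s t\<close> is
    replaced by \<open>E 0 T\<close>.\<close>
  define L where "L = K * C * T powr (H - \<alpha>) * E 0 T powr (1 / 2)"
  have "norm (young_integral x z s t) \<le> L * (t - s) powr (2 * \<alpha>)" if st: "0 \<le> s" "s \<le> t" "t \<le> T" for s t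
  proof -
    have "norm (young_integral x z s t) \<le> K * (C * ((t - s) powr (\<alpha> + H) * E s t powr (1 / 2)))"
      using J(2)[OF st] by (simp add: eq[OF st] \<omega>_powr)
    also have "\<dots> \<le> K * (C * ((T powr (H - \<alpha>) * (t - s) powr (2 * \<alpha>)) * E 0 T powr (1 / 2)))"
      using st J(4) assms powr_le_powr_smaller[of "t - s" T "2 * \<alpha>" "\<alpha> + H"]
        control_nonneg[OF assms(1) st] control_mono[OF assms(1), of 0 s t T]
      by (intro mult_left_mono mult_mono powr_mono2) (auto simp: algebra_simps)
    finally show ?thesis
      by (simp add: L_def mult_ac)
  qed
  moreover have "0 \<le> L"
    using J(4) assms(2) by (simp add: L_def)
  moreover have "young_integrable T x z"
    unfolding young_integrable_def using reg J(1) by blast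
  moreover have "young_integral x z s t = young_integral x z s r + young_integral x z r t + incr x s r \<otimes>\<^sub>v incr z r t"
    if "0 \<le> s" "s \<le> r" "r \<le> t" "t \<le> T" for s r t
    using J(3)[OF that] eq that by simp
  ultimately show ?thesis
    unfolding young_pair_def by blast
qed

lemma young_pair_hoelder_cm_regular:
  fixes x :: "real \<Rightarrow> real ^ 'm" and h :: "real \<Rightarrow> real ^ 'n"
  assumes "hoelder T \<alpha> x" "cm_regular T H h" "0 < \<alpha>" "\<alpha> \<le> H" "1 / 2 < \<alpha> + H" "H \<le> 1 / 2"
  shows "young_pair T \<alpha> x h" "young_pair T \<alpha> h x"
proof -
  obtain C where C: "0 \<le> C" "\<And>s t. 0 \<le> s \<Longrightarrow> s \<le> t \<Longrightarrow> t \<le> T \<Longrightarrow> norm (incr x s t) \<le> C * (t - s) powr \<alpha>"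
    using assms(1) unfolding hoelder_def by blast
  obtain E where E: "control T E"
    "\<And>s t. 0 \<le> s \<Longrightarrow> s \<le> t \<Longrightarrow> t \<le> T \<Longrightarrow> norm (incr h s t) \<le> (t - s) powr H * E s t powr (1 / 2)"
    using cm_regularE[OF assms(2)] by blast
  \<comment> \<open>The subintervals for \<open>x\<close> and \<open>h\<close> are chosen
    independently, so one estimate serves both orders of integration.\<close>
  have bound: "norm (incr x a b) * norm (incr h c d) \<le> C * ((q - p) powr (\<alpha> + H) * E p q powr (1 / 2))"
    if "0 \<le> p" "p \<le> a" "a \<le> b" "b \<le> q" "p \<le> c" "c \<le> d" "d \<le> q" "q \<le> T" for a b c d p q
  proof -
    have "norm (incr x a b) \<le> C * (b - a) powr \<alpha>"
      using C(2)[of a b] that by simp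
    also have "\<dots> \<le> C * (q - p) powr \<alpha>"
      using that assms C(1) by (intro mult_left_mono powr_mono2) auto
    finally have x: "norm (incr x a b) \<le> C * (q - p) powr \<alpha>" .
    have "norm (incr h c d) \<le> (d - c) powr H * E c d powr (1 / 2)"
      using E(2)[of c d] that by simp
    also have "\<dots> \<le> (q - p) powr H * E p q powr (1 / 2)"
      using that assms control_nonneg[OF E(1), of c d] control_mono[OF E(1), of p c d q]
      by (intro mult_mono powr_mono2) auto
    finally have "norm (incr h c d) \<le> (q - p) powr H * E p q powr (1 / 2)" .
    with x have "norm (incr x a b) * norm (incr h c d)
        \<le> (C * (q - p) powr \<alpha>) * ((q - p) powr H * E p q powr (1 / 2))"
      using C(1) by (intro mult_mono) auto
    then show ?thesis
      by (simp add: powr_add mult_ac)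
  qed
  have cont: "continuous_on {0..T} x" "continuous_on {0..T} h"
    using hoelder_continuous_on[OF assms(1,3)] hoelder_continuous_on[OF cm_regular_hoelder[OF assms(2,4)] assms(3)]
    by auto
  have fv: "finite_variation (1 / \<alpha>) 0 T x" "finite_variation (1 / (H + 1 / 2)) 0 T h"
    using hoelder_finite_variation[OF assms(1,3)] cm_regular_finite_variation[OF assms(2)] assms
    by auto
  \<comment> \<open>The reciprocals of the variation exponents add up to
    \<open>\<alpha> + H + 1 / 2\<close>, and \<open>H \<le> 1 / 2\<close> makes both exponents at
    least 1.\<close>
  have exps: "1 \<le> 1 / \<alpha>" "1 \<le> 1 / (H + 1 / 2)" "1 / (1 / \<alpha>) + 1 / (1 / (H + 1 / 2)) > 1"
    using assms by (auto simp: field_simps)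
  show "young_pair T \<alpha> x h"
  proof (rule young_pair_if_dominated[OF E(1) C(1) assms(3-5) _ cont])
    show "\<exists>p\<ge>1. \<exists>q\<ge>1. 1 < 1 / p + 1 / q \<and> finite_variation p 0 T x \<and> finite_variation q 0 T h"
      using exps fv by (intro exI[of _ "1 / \<alpha>"] conjI exI[of _ "1 / (H + 1 / 2)"])
  qed (rule bound; simp)
  show "young_pair T \<alpha> h x"
  proof (rule young_pair_if_dominated[OF E(1) C(1) assms(3-5) _ cont(2,1)])
    show "\<exists>p\<ge>1. \<exists>q\<ge>1. 1 < 1 / p + 1 / q \<and> finite_variation p 0 T h \<and> finite_variation q 0 T x"
      using exps fv by (intro exI[of _ "1 / (H + 1 / 2)"] conjI exI[of _ "1 / \<alpha>"]) (simp_all add: add.commute)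
  next
    fix p r r' q
    assume "0 \<le> p" "p \<le> r" "r \<le> q" "p \<le> r'" "r' \<le> q" "q \<le> T"
    then show "norm (incr h p r) * norm (incr x r' q) \<le> C * ((q - p) powr (\<alpha> + H) * E p q powr (1 / 2))"
      using bound[where p = p and q = q and a = r' and b = q and c = p and d = r] by (simp add: mult.commute)
  qed
qed

subsection \<open>Increments of the fractional covariance\<close>

text \<open>The covariance of the increments over \<open>[a, b]\<close> and \<open>[c, d]\<close>,
  in which the powers of the single times have cancelled.\<close>

definition fbm_incr_cov :: "real \<Rightarrow> real \<Rightarrow> real \<Rightarrow> real \<Rightarrow> real \<Rightarrow> real"
  where "fbm_incr_cov H a b c d =
      (\<bar>b - c\<bar> powr (2 * H) + \<bar>a - d\<bar> powr (2 * H) - \<bar>b - d\<bar> powr (2 * H) - \<bar>a - c\<bar> powr (2 * H)) / 2"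

lemma fbm_incr_cov_eq:
  "fbm_cov H b d - fbm_cov H b c - (fbm_cov H a d - fbm_cov H a c) = fbm_incr_cov H a b c d"
  by (simp add: fbm_cov_def fbm_incr_cov_def abs_minus_commute field_simps)

text \<open>Concavity of \<open>t powr p\<close>: its increment over a step of length
  \<open>y\<close> does not grow when the step is shifted from \<open>x\<close> to
  \<open>x + z\<close>.\<close>

lemma powr_four_point:
  fixes x y z :: real
  assumes "0 \<le> x" "0 \<le> y" "0 \<le> z" "0 < p" "p \<le> 1"
  shows "x powr p + (x + y + z) powr p \<le> (x + z) powr p + (x + y) powr p"
proof -
  let ?f = "\<lambda>t. (t + y) powr p - t powr p"
  have "?f (x + z) \<le> ?f x"
  proof (rule DERIV_nonpos_imp_decreasing_open[where f = ?f])
    show "x \<le> x + z"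
      using assms by simp
    show "continuous_on {x..x + z} ?f"
      using assms by (intro continuous_intros continuous_on_powr') auto
    fix t
    assume t: "x < t" "t < x + z"
    then have "0 < t"
      using assms by simp
    then have "(?f has_real_derivative (p * (t + y) powr (p - 1) - p * t powr (p - 1))) (at t)"
      using assms by (auto intro!: derivative_eq_intros)
    moreover have "(t + y) powr (p - 1) \<le> t powr (p - 1)"
      using assms \<open>0 < t\<close> by (intro powr_mono2') auto
    ultimately show "\<exists>d. (?f has_real_derivative d) (at t) \<and> d \<le> 0"
      using assms by (intro exI conjI) (auto simp: mult_left_mono)
  qed
  then show ?thesis
    by (simp add: algebra_simps)
qed

text \<open>With gap \<open>x\<close> and lengths \<open>y\<close> and \<open>z\<close> of the
  intervals, the four distances are \<open>x\<close>, \<open>x + y\<close>, \<open>x + z\<close> and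
  \<open>x + y + z\<close>, and \<open>powr_four_point\<close> applies.\<close>

lemma fbm_incr_cov_disjoint:
  assumes "0 < H" "H \<le> 1 / 2" "a \<le> b" "c \<le> d" "b \<le> c \<or> d \<le> a"
  shows "fbm_incr_cov H a b c d \<le> 0"
  using assms(5)
proof
  assume "b \<le> c"
  then show ?thesis
    using powr_four_point[of "c - b" "b - a" "d - c" "2 * H"] assms
    by (simp add: fbm_incr_cov_def algebra_simps)
next
  assume "d \<le> a"
  then show ?thesis
    using powr_four_point[of "a - d" "d - c" "b - a" "2 * H"] assms
    by (simp add: fbm_incr_cov_def algebra_simps)
qed

text \<open>The four powers group into two differences, each nonnegative by monotonicity alone;
  concavity does not enter.\<close>

lemma fbm_incr_cov_nested:
  assumes "0 < H" "c \<le> a" "a \<le> b" "b \<le> d"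
  shows "0 \<le> fbm_incr_cov H a b c d"
proof -
  have "(a - c) powr (2 * H) \<le> (b - c) powr (2 * H)" "(d - b) powr (2 * H) \<le> (d - a) powr (2 * H)"
    using assms by (auto intro!: powr_mono2)
  then show ?thesis
    using assms by (simp add: fbm_incr_cov_def)
qed

lemma fbm_incr_cov_same: "a \<le> b \<Longrightarrow> fbm_incr_cov H a b a b = (b - a) powr (2 * H)"
  by (simp add: fbm_incr_cov_def)

lemma fbm_incr_cov_commute: "fbm_incr_cov H a b c d = fbm_incr_cov H c d a b"
  by (simp add: fbm_incr_cov_def abs_minus_commute)

lemma fbm_incr_cov_sum:
  "(\<Sum>j<n. fbm_incr_cov H a b (\<tau> j) (\<tau> (Suc j))) = fbm_incr_cov H a b (\<tau> 0) (\<tau> n)"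
proof -
  define g where "g c = (\<bar>a - c\<bar> powr (2 * H) - \<bar>b - c\<bar> powr (2 * H)) / 2" for c
  have "fbm_incr_cov H a b c d = g d - g c" for c d
    by (simp add: fbm_incr_cov_def g_def field_simps)
  then show ?thesis
    using sum_lessThan_telescope[of "\<lambda>j. g (\<tau> j)"] by simp
qed

text \<open>Disjoint increments are negatively correlated, so that the absolute row sum is twice the
  diagonal entry minus the row sum, which telescopes.\<close>

lemma fbm_incr_cov_abs_sum:
  assumes H: "0 < H" "H \<le> 1 / 2" and \<tau>: "interval_partition s t n \<tau>" and "i < n"
  shows "(\<Sum>j<n. \<bar>fbm_incr_cov H (\<tau> i) (\<tau> (Suc i)) (\<tau> j) (\<tau> (Suc j))\<bar>)
    \<le> 2 * (\<tau> (Suc i) - \<tau> i) powr (2 * H)"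
proof -
  let ?R = "\<lambda>j. fbm_incr_cov H (\<tau> i) (\<tau> (Suc i)) (\<tau> j) (\<tau> (Suc j))"
  note step = interval_partition_step[OF \<tau>]
  \<comment> \<open>The diagonal entry is nonnegative and the others are nonpositive, so the
    absolute row is minus the row with the diagonal corrected by twice its entry.\<close>
  have "\<bar>?R j\<bar> = (if j = i then 2 * ?R i else 0) - ?R j" if "j < n" for j
  proof (cases "j = i")
    case True
    then show ?thesis
      using step[OF \<open>i < n\<close>] by (simp add: fbm_incr_cov_same)
  next
    case False
    then have "\<tau> (Suc i) \<le> \<tau> j \<or> \<tau> (Suc j) \<le> \<tau> i"
      using interval_partition_mono[OF \<tau>, of "Suc i" j] interval_partition_mono[OF \<tau>, of "Suc j" i]
        that \<open>i < n\<close> by linarith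
    then have "?R j \<le> 0"
      using step[OF that] step[OF \<open>i < n\<close>] by (intro fbm_incr_cov_disjoint H)
    then show ?thesis
      using False by simp
  qed
  then have "(\<Sum>j<n. \<bar>?R j\<bar>) = 2 * ?R i - fbm_incr_cov H (\<tau> i) (\<tau> (Suc i)) (\<tau> 0) (\<tau> n)"
    using \<open>i < n\<close> by (simp add: sum_subtractf fbm_incr_cov_sum)
  \<comment> \<open>The row sum is the covariance with the increment over all of
    \<open>[s, t]\<close>, in which the cell is nested.\<close>
  moreover have "0 \<le> fbm_incr_cov H (\<tau> i) (\<tau> (Suc i)) (\<tau> 0) (\<tau> n)"
    using interval_partition_mono[OF \<tau>, of 0 i] interval_partition_mono[OF \<tau>, of "Suc i" n]
      step[OF \<open>i < n\<close>] \<open>i < n\<close> by (intro fbm_incr_cov_nested H) auto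
  ultimately show ?thesis
    using step[OF \<open>i < n\<close>] by (simp add: fbm_incr_cov_same)
qed

text \<open>Schur's test: each product \<open>e i * e j\<close> is split into halves of the two
  squares, and by symmetry of the matrix only its absolute row sums remain.\<close>

lemma fbm_incr_cov_quadratic:
  assumes H: "0 < H" "H \<le> 1 / 2" and \<tau>: "interval_partition s t n \<tau>"
  shows "(\<Sum>i<n. e i * (\<Sum>j<n. e j * fbm_incr_cov H (\<tau> i) (\<tau> (Suc i)) (\<tau> j) (\<tau> (Suc j))))
    \<le> 2 * (\<Sum>i<n. (e i)\<^sup>2 * (\<tau> (Suc i) - \<tau> i) powr (2 * H))"
proof -
  let ?R = "\<lambda>i j. fbm_incr_cov H (\<tau> i) (\<tau> (Suc i)) (\<tau> j) (\<tau> (Suc j))"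
  have "e i * (e j * ?R i j) \<le> (e i)\<^sup>2 / 2 * \<bar>?R i j\<bar> + (e j)\<^sup>2 / 2 * \<bar>?R j i\<bar>" for i j
  proof -
    have "2 * \<bar>e i * e j\<bar> \<le> (e i)\<^sup>2 + (e j)\<^sup>2"
      using sum_squares_bound[of "\<bar>e i\<bar>" "\<bar>e j\<bar>"] by (simp add: abs_mult)
    then have "\<bar>e i * e j\<bar> * \<bar>?R i j\<bar> \<le> ((e i)\<^sup>2 + (e j)\<^sup>2) / 2 * \<bar>?R i j\<bar>"
      by (intro mult_right_mono) auto
    moreover have "e i * (e j * ?R i j) \<le> \<bar>e i * e j\<bar> * \<bar>?R i j\<bar>"
      by (metis abs_ge_self abs_mult mult.assoc)
    ultimately show ?thesis
      using fbm_incr_cov_commute[of H "\<tau> i" "\<tau> (Suc i)" "\<tau> j" "\<tau> (Suc j)"]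
      by (simp add: field_simps)
  qed
  then have "(\<Sum>i<n. e i * (\<Sum>j<n. e j * ?R i j))
      \<le> (\<Sum>i<n. \<Sum>j<n. (e i)\<^sup>2 / 2 * \<bar>?R i j\<bar> + (e j)\<^sup>2 / 2 * \<bar>?R j i\<bar>)"
    unfolding sum_distrib_left by (intro sum_mono)
  also have "\<dots> = (\<Sum>i<n. \<Sum>j<n. (e i)\<^sup>2 / 2 * \<bar>?R i j\<bar>) + (\<Sum>i<n. \<Sum>j<n. (e j)\<^sup>2 / 2 * \<bar>?R j i\<bar>)"
    by (simp add: sum.distrib)
  also have "(\<Sum>i<n. \<Sum>j<n. (e j)\<^sup>2 / 2 * \<bar>?R j i\<bar>) = (\<Sum>i<n. \<Sum>j<n. (e i)\<^sup>2 / 2 * \<bar>?R i j\<bar>)"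
    by (rule sum.swap)
  also have "(\<Sum>i<n. \<Sum>j<n. (e i)\<^sup>2 / 2 * \<bar>?R i j\<bar>) + (\<Sum>i<n. \<Sum>j<n. (e i)\<^sup>2 / 2 * \<bar>?R i j\<bar>)
      = (\<Sum>i<n. (e i)\<^sup>2 * (\<Sum>j<n. \<bar>?R i j\<bar>))"
    by (simp add: sum_distrib_left flip: sum.distrib)
  also have "\<dots> \<le> (\<Sum>i<n. (e i)\<^sup>2 * (2 * (\<tau> (Suc i) - \<tau> i) powr (2 * H)))"
    using fbm_incr_cov_abs_sum[OF H \<tau>] by (intro sum_mono mult_left_mono) auto
  finally show ?thesis
    by (simp add: sum_distrib_left mult_ac)
qed


subsection \<open>Regularity of Cameron--Martin paths\<close>

text \<open>For \<open>H = 1 / 2\<close> this is the energy of the piecewise linear interpolation of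
  \<open>h\<close> along the partition. Degenerate cells contribute 0, as division by 0 gives
  0.\<close>

definition weighted_energy :: "real \<Rightarrow> (real \<Rightarrow> real) \<Rightarrow> nat \<Rightarrow> (nat \<Rightarrow> real) \<Rightarrow> real"
  where "weighted_energy H h n \<tau> =
      (\<Sum>i<n. (incr h (\<tau> i) (\<tau> (Suc i)))\<^sup>2 / (\<tau> (Suc i) - \<tau> i) powr (2 * H))"

lemma weighted_energy_nonneg: "0 \<le> weighted_energy H h n \<tau>"
  by (simp add: weighted_energy_def sum_nonneg)

text \<open>The control is the supremum of the energies over partitions of subintervals of
  \<open>[s, t]\<close>. Concatenation makes it superadditive, and the one-cell partition yields the
  estimate of the increment.\<close>

lemma cm_regularI:
  fixes h :: "real \<Rightarrow> real"
  assumes bound: "\<And>s t n \<tau>. interval_partition s t n \<tau> \<Longrightarrow> 0 \<le> s \<Longrightarrow> t \<le> T \<Longrightarrow> weighted_energy H h n \<tau> \<le> B"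
  shows "cm_regular T H h"
proof -
  define V where "V s t = {weighted_energy H h n \<tau> | n \<tau> a b. interval_partition a b n \<tau> \<and> s \<le> a \<and> b \<le> t}"
    for s t
  define E where "E s t = Sup (V s t)" for s t
  have bdd: "bdd_above (V s t)" if "0 \<le> s" "t \<le> T" for s t
    using that bound by (intro bdd_aboveI[of _ B]) (auto simp: V_def)
  have upper: "weighted_energy H h n \<tau> \<le> E s t"
    if "interval_partition a b n \<tau>" "s \<le> a" "b \<le> t" "0 \<le> s" "t \<le> T" for a b n \<tau> s t
    unfolding E_def using that by (intro cSup_upper bdd) (auto simp: V_def)
  have single: "interval_partition s t 1 (\<lambda>i. if i = 0 then s else t)" if "s \<le> t" for s t
    using that by (simp add: interval_partition_def)
  have ne: "V s t \<noteq> {}" if "s \<le> t" for s t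
    using single[OF that] by (fastforce simp: V_def)
  have "control T E"
    unfolding control_def
  proof (intro conjI allI impI)
    fix s t
    assume "0 \<le> s \<and> s \<le> t \<and> t \<le> T"
    then show "0 \<le> E s t"
      using upper[OF single[of s t]] weighted_energy_nonneg order_trans by blast
  next
    fix s r t
    assume st: "0 \<le> s \<and> s \<le> r \<and> r \<le> t \<and> t \<le> T"
    have add: "x + y \<le> E s t" if "x \<in> V s r" "y \<in> V r t" for x y
    proof -
      from that obtain n \<tau> a b m \<sigma> c d where \<tau>: "x = weighted_energy H h n \<tau>"
        "interval_partition a b n \<tau>" "s \<le> a" "b \<le> r"
        and \<sigma>: "y = weighted_energy H h m \<sigma>" "interval_partition c d m \<sigma>" "r \<le> c" "d \<le> t"
        unfolding V_def by blast
      \<comment> \<open>\<open>\<tau>\<close> followed by \<open>\<sigma>\<close>, with a joining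
        cell from \<open>\<tau> n\<close> to \<open>\<sigma> 0\<close>; hence
        \<open>Suc (n + m)\<close> cells, the additional one contributing a nonnegative
        term.\<close>
      define \<rho> where "\<rho> i = (if i \<le> n then \<tau> i else \<sigma> (i - Suc n))" for i
      have part: "interval_partition a d (Suc (n + m)) \<rho>"
        unfolding interval_partition_def
      proof (intro conjI allI impI)
        fix i
        assume "i < Suc (n + m)"
        then consider "i < n" | "i = n" | "n < i" "i - Suc n < m"
          by linarith
        then show "\<rho> i \<le> \<rho> (Suc i)"
        proof cases
          case 3
          then show ?thesis
            using interval_partition_step[OF \<sigma>(2), of "i - Suc n"] by (simp add: \<rho>_def Suc_diff_Suc)
        qed (use \<tau> \<sigma> in \<open>auto simp: \<rho>_def interval_partition_def\<close>)
      qed (use \<tau> \<sigma> in \<open>auto simp: \<rho>_def interval_partition_def\<close>)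
      have "weighted_energy H h (Suc (n + k)) \<rho> = weighted_energy H h (Suc n) \<rho> + weighted_energy H h k \<sigma>" for k
        by (induction k) (auto simp: weighted_energy_def \<rho>_def)
      moreover have "weighted_energy H h n \<rho> = weighted_energy H h n \<tau>"
        unfolding weighted_energy_def by (intro sum.cong) (auto simp: \<rho>_def)
      moreover have "weighted_energy H h n \<rho> \<le> weighted_energy H h (Suc n) \<rho>"
        by (simp add: weighted_energy_def)
      ultimately have "x + y \<le> weighted_energy H h (Suc (n + m)) \<rho>"
        by (simp add: \<tau>(1) \<sigma>(1))
      also have "\<dots> \<le> E s t"
        using upper[OF part] \<tau> \<sigma> st by simp
      finally show ?thesis .
    qed
    \<comment> \<open>The supremum is taken over \<open>x\<close> with \<open>y\<close> fixed, and
      afterwards over \<open>y\<close>.\<close>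
    have "E s r \<le> E s t - y" if "y \<in> V r t" for y
      unfolding E_def[of s r] using st add that by (intro cSup_least ne) (auto simp: algebra_simps)
    then have "E r t \<le> E s t - E s r"
      unfolding E_def[of r t] using st by (intro cSup_least ne) (auto simp: algebra_simps)
    then show "E s r + E r t \<le> E s t"
      by simp
  qed
  moreover have "(norm (incr h s t))\<^sup>2 \<le> E s t * (t - s) powr (2 * H)" if "0 \<le> s" "s \<le> t" "t \<le> T" for s t
  proof (cases "s = t")
    case False
    then have "0 < (t - s) powr (2 * H)"
      using that by simp
    then show ?thesis
      using upper[OF single[OF that(2)] order_refl order_refl that(1,3)]
      by (simp add: weighted_energy_def field_simps)
  qed (simp add: incr_def)
  ultimately show ?thesis
    unfolding cm_regular_def by blast
qed

text \<open>The squared Euclidean norm is the sum over the coordinates, and a finite sum of controls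
  is a control.\<close>

lemma cm_regular_vec:
  fixes h :: "real \<Rightarrow> real ^ 'n"
  assumes "\<And>i. cm_regular T H (\<lambda>t. h t $ i)"
  shows "cm_regular T H h"
proof -
  have "\<forall>i. \<exists>E. control T E \<and> (\<forall>s t. 0 \<le> s \<and> s \<le> t \<and> t \<le> T \<longrightarrow>
      (norm (incr (\<lambda>t. h t $ i) s t))\<^sup>2 \<le> E s t * (t - s) powr (2 * H))"
    using assms unfolding cm_regular_def by blast
  then obtain E where E: "\<And>i. control T (E i)" "\<And>i s t. 0 \<le> s \<Longrightarrow> s \<le> t \<Longrightarrow> t \<le> T \<Longrightarrow>
      (norm (incr (\<lambda>t. h t $ i) s t))\<^sup>2 \<le> E i s t * (t - s) powr (2 * H)"
    by (auto dest!: choice)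
  have "control T (\<lambda>s t. \<Sum>i\<in>UNIV. E i s t)"
    unfolding control_def sum.distrib[symmetric]
    using control_nonneg[OF E(1)] control_superadditive[OF E(1)]
    by (auto intro!: sum_nonneg sum_mono)
  moreover have "(norm (incr h s t))\<^sup>2 \<le> (\<Sum>i\<in>UNIV. E i s t) * (t - s) powr (2 * H)"
    if "0 \<le> s" "s \<le> t" "t \<le> T" for s t
  proof -
    have "(norm (incr h s t))\<^sup>2 = (\<Sum>i\<in>UNIV. (norm (incr (\<lambda>t. h t $ i) s t))\<^sup>2)"
      by (simp add: norm_vec_def L2_set_def sum_nonneg incr_def)
    also have "\<dots> \<le> (\<Sum>i\<in>UNIV. E i s t * (t - s) powr (2 * H))"
      using E(2) that by (intro sum_mono) auto
    finally show ?thesis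
      by (simp add: sum_distrib_right)
  qed
  ultimately show ?thesis
    unfolding cm_regular_def by (intro exI[of _ "\<lambda>s t. \<Sum>i\<in>UNIV. E i s t"]) auto
qed

lemma cm_regular_mono:
  assumes "cm_regular T H' h" "H \<le> H'"
  shows "cm_regular T H h"
proof -
  obtain E where E: "control T E" "\<And>s t. 0 \<le> s \<Longrightarrow> s \<le> t \<Longrightarrow> t \<le> T \<Longrightarrow>
      (norm (incr h s t))\<^sup>2 \<le> E s t * (t - s) powr (2 * H')"
    using assms(1) unfolding cm_regular_def by blast
  let ?C = "T powr (2 * H' - 2 * H)"
  have "control T (\<lambda>s t. E s t * ?C)"
    using control_nonneg[OF E(1)] control_superadditive[OF E(1)]
    by (auto simp: control_def mult_right_mono simp flip: distrib_right)
  moreover have "(norm (incr h s t))\<^sup>2 \<le> E s t * ?C * (t - s) powr (2 * H)"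
    if st: "0 \<le> s" "s \<le> t" "t \<le> T" for s t
  proof -
    have "E s t * (t - s) powr (2 * H') \<le> E s t * (?C * (t - s) powr (2 * H))"
      using powr_le_powr_smaller[of "t - s" T "2 * H" "2 * H'"] st assms(2) control_nonneg[OF E(1) st]
      by (intro mult_left_mono) auto
    with E(2)[OF st] show ?thesis
      by (simp add: mult_ac)
  qed
  ultimately show ?thesis
    unfolding cm_regular_def by (intro exI[of _ "\<lambda>s t. E s t * ?C"]) auto
qed

section \<open>Finite kernel combinations and feature maps\<close>

lemma kernel_comb_superset:
  assumes "finite A" "{a. c a \<noteq> 0} \<subseteq> A"
  shows "kernel_comb K c t = (\<Sum>a\<in>A. c a * K a t)"
  unfolding kernel_comb_def using assms by (intro sum.mono_neutral_left) auto

lemma kernel_comb_diff: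
  assumes "c \<in> kernel_coeffs I" "c' \<in> kernel_coeffs I"
  shows "(\<lambda>a. c a - c' a) \<in> kernel_coeffs I"
    and "kernel_comb K (\<lambda>a. c a - c' a) t = kernel_comb K c t - kernel_comb K c' t"
proof -
  let ?A = "{a. c a \<noteq> 0} \<union> {a. c' a \<noteq> 0}"
  have A: "finite ?A" "?A \<subseteq> I"
    using assms by (auto simp: kernel_coeffs_def)
  have sub: "{a. c a - c' a \<noteq> 0} \<subseteq> ?A"
    by auto
  show "(\<lambda>a. c a - c' a) \<in> kernel_coeffs I"
    unfolding kernel_coeffs_def using finite_subset[OF sub A(1)] sub A(2) by blast
  show "kernel_comb K (\<lambda>a. c a - c' a) t = kernel_comb K c t - kernel_comb K c' t"
    using kernel_comb_superset[OF A(1) sub, of K t] kernel_comb_superset[OF A(1), of c K t]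
      kernel_comb_superset[OF A(1), of c' K t]
    by (auto simp: left_diff_distrib sum_subtractf)
qed

text \<open>A feature map: the kernel is realised by inner products of functions in
  \<open>L2\<close> of \<open>N\<close>, so that its positive semidefiniteness becomes nonnegativity
  of the integral of a square. \<open>N\<close> may be any measure, which admits both a process and
  a deterministic family.\<close>

locale fbm_feature =
  fixes T H :: real and N :: "'b measure" and \<phi> :: "real \<Rightarrow> 'b \<Rightarrow> real"
  assumes H: "0 < H" "H \<le> 1 / 2"
    and feature: "s \<in> {0..T} \<Longrightarrow> t \<in> {0..T} \<Longrightarrow>
      has_bochner_integral N (\<lambda>\<omega>. \<phi> s \<omega> * \<phi> t \<omega>) (fbm_cov H s t)"
begin

text \<open>Duality: \<open>S\<close> represents the kernel combination, \<open>Y\<close> is a test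
  combination of increments, and the integral of \<open>(S - Y)\<^sup>2\<close> is nonnegative. The
  mixed term produces the energy, and \<open>fbm_incr_cov_quadratic\<close> bounds the integral of
  the square of \<open>Y\<close>.\<close>

lemma weighted_energy_kernel_comb:
  assumes c: "c \<in> kernel_coeffs {0..T}" and \<tau>: "interval_partition s t n \<tau>" and st: "0 \<le> s" "t \<le> T"
  shows "weighted_energy H (kernel_comb (fbm_cov H) c) n \<tau> \<le> 2 * kernel_sqnorm (fbm_cov H) c"
proof -
  let ?A = "{a. c a \<noteq> 0}"
  let ?h = "kernel_comb (fbm_cov H) c"
  let ?d = "\<lambda>i. (\<tau> (Suc i) - \<tau> i) powr (2 * H)"
  let ?hi = "\<lambda>i. incr ?h (\<tau> i) (\<tau> (Suc i))"
  have A: "?A \<subseteq> {0..T}"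
    using c by (auto simp: kernel_coeffs_def)
  have \<tau>_in: "i \<le> n \<Longrightarrow> \<tau> i \<in> {0..T}" for i
    using interval_partition_bounds[OF \<tau>, of i] st by auto
  define S where "S \<omega> = (\<Sum>a\<in>?A. c a * \<phi> a \<omega>)" for \<omega>
  \<comment> \<open>The factor 1/2 optimises the bound: coefficients \<open>l\<close> times the
    quotient of increment and weight give the mixed contribution \<open>2 * l\<close> and the
    quadratic one at most \<open>2 * l^2\<close>, in units of the energy.\<close>
  define e where "e i = ?hi i / (2 * ?d i)" for i
  define Y where "Y \<omega> = (\<Sum>i<n. e i * (\<phi> (\<tau> (Suc i)) \<omega> - \<phi> (\<tau> i) \<omega>))" for \<omega>
  \<comment> \<open>The reproducing property: pairing with \<open>\<phi> t\<close> evaluates the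
    kernel combination at \<open>t\<close>.\<close>
  have S_feature: "has_bochner_integral N (\<lambda>\<omega>. S \<omega> * \<phi> t \<omega>) (?h t)" if "t \<in> {0..T}" for t
    unfolding S_def kernel_comb_def sum_distrib_right mult.assoc
    using A that by (intro has_bochner_integral_sum has_bochner_integral_mult_right feature) auto
  have SS: "has_bochner_integral N (\<lambda>\<omega>. S \<omega> * S \<omega>) (kernel_sqnorm (fbm_cov H) c)"
  proof -
    have "has_bochner_integral N (\<lambda>\<omega>. \<Sum>a\<in>?A. c a * (S \<omega> * \<phi> a \<omega>)) (\<Sum>a\<in>?A. c a * ?h a)"
      using A by (intro has_bochner_integral_sum has_bochner_integral_mult_right S_feature) auto
    moreover have "(\<Sum>a\<in>?A. c a * (S \<omega> * \<phi> a \<omega>)) = S \<omega> * S \<omega>" for \<omega>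
      by (subst (3) S_def) (simp add: sum_distrib_left mult_ac)
    moreover have "(\<Sum>a\<in>?A. c a * ?h a) = kernel_sqnorm (fbm_cov H) c"
      unfolding kernel_sqnorm_def kernel_comb_def sum_distrib_left
      by (subst sum.swap) (simp add: mult_ac)
    ultimately show ?thesis
      by simp
  qed
  have SY: "has_bochner_integral N (\<lambda>\<omega>. S \<omega> * Y \<omega>) (\<Sum>i<n. e i * ?hi i)"
  proof -
    have "has_bochner_integral N (\<lambda>\<omega>. \<Sum>i<n. e i * (S \<omega> * \<phi> (\<tau> (Suc i)) \<omega> - S \<omega> * \<phi> (\<tau> i) \<omega>))
        (\<Sum>i<n. e i * ?hi i)"
      unfolding incr_def using \<tau>_in
      by (intro has_bochner_integral_sum has_bochner_integral_mult_right has_bochner_integral_diff S_feature)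
        auto
    moreover have "(\<Sum>i<n. e i * (S \<omega> * \<phi> (\<tau> (Suc i)) \<omega> - S \<omega> * \<phi> (\<tau> i) \<omega>)) = S \<omega> * Y \<omega>" for \<omega>
      unfolding Y_def sum_distrib_left by (intro sum.cong) (auto simp: algebra_simps)
    ultimately show ?thesis
      by simp
  qed
  let ?R = "\<lambda>i j. fbm_incr_cov H (\<tau> i) (\<tau> (Suc i)) (\<tau> j) (\<tau> (Suc j))"
  have YY: "has_bochner_integral N (\<lambda>\<omega>. Y \<omega> * Y \<omega>) (\<Sum>i<n. e i * (\<Sum>j<n. e j * ?R i j))"
  proof -
    let ?X = "\<lambda>i \<omega>. \<phi> (\<tau> (Suc i)) \<omega> - \<phi> (\<tau> i) \<omega>"
    have "has_bochner_integral N (\<lambda>\<omega>. ?X i \<omega> * ?X j \<omega>) (?R i j)" if "i < n" "j < n" for i j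
    proof -
      have "has_bochner_integral N
          (\<lambda>\<omega>. \<phi> (\<tau> (Suc i)) \<omega> * \<phi> (\<tau> (Suc j)) \<omega> - \<phi> (\<tau> (Suc i)) \<omega> * \<phi> (\<tau> j) \<omega>
            - (\<phi> (\<tau> i) \<omega> * \<phi> (\<tau> (Suc j)) \<omega> - \<phi> (\<tau> i) \<omega> * \<phi> (\<tau> j) \<omega>)) (?R i j)"
        unfolding fbm_incr_cov_eq[symmetric] using that \<tau>_in
        by (intro has_bochner_integral_diff feature) auto
      then show ?thesis
        by (simp add: algebra_simps)
    qed
    then have "has_bochner_integral N (\<lambda>\<omega>. \<Sum>i<n. e i * (\<Sum>j<n. e j * (?X i \<omega> * ?X j \<omega>)))
        (\<Sum>i<n. e i * (\<Sum>j<n. e j * ?R i j))"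
      by (intro has_bochner_integral_sum has_bochner_integral_mult_right) auto
    moreover have "(\<Sum>i<n. e i * (\<Sum>j<n. e j * (?X i \<omega> * ?X j \<omega>))) = Y \<omega> * Y \<omega>" for \<omega>
      unfolding Y_def sum_product by (simp add: sum_distrib_left mult_ac)
    ultimately show ?thesis
      by simp
  qed
  have "has_bochner_integral N (\<lambda>\<omega>. (S \<omega> * S \<omega> - 2 * (S \<omega> * Y \<omega>)) + Y \<omega> * Y \<omega>)
      ((kernel_sqnorm (fbm_cov H) c - 2 * (\<Sum>i<n. e i * ?hi i)) + (\<Sum>i<n. e i * (\<Sum>j<n. e j * ?R i j)))"
    by (intro has_bochner_integral_add has_bochner_integral_diff has_bochner_integral_mult_right SS SY YY)
  moreover have "(S \<omega> * S \<omega> - 2 * (S \<omega> * Y \<omega>)) + Y \<omega> * Y \<omega> = (S \<omega> - Y \<omega>)\<^sup>2" for \<omega>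
    by (simp add: power2_eq_square algebra_simps)
  ultimately have "has_bochner_integral N (\<lambda>\<omega>. (S \<omega> - Y \<omega>)\<^sup>2)
      ((kernel_sqnorm (fbm_cov H) c - 2 * (\<Sum>i<n. e i * ?hi i)) + (\<Sum>i<n. e i * (\<Sum>j<n. e j * ?R i j)))"
    by simp
  from has_bochner_integral_integral_eq[OF this]
  have "0 \<le> (kernel_sqnorm (fbm_cov H) c - 2 * (\<Sum>i<n. e i * ?hi i))
      + (\<Sum>i<n. e i * (\<Sum>j<n. e j * ?R i j))"
    by (metis (no_types, lifting) Bochner_Integration.integral_nonneg zero_le_power2)
  moreover have "(\<Sum>i<n. e i * (\<Sum>j<n. e j * ?R i j)) \<le> 2 * (\<Sum>i<n. (e i)\<^sup>2 * ?d i)"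
    by (rule fbm_incr_cov_quadratic[OF H \<tau>])
  moreover have "(\<Sum>i<n. e i * ?hi i) = weighted_energy H ?h n \<tau> / 2"
    unfolding weighted_energy_def sum_divide_distrib
    by (intro sum.cong) (auto simp: e_def power2_eq_square)
  moreover have "(\<Sum>i<n. (e i)\<^sup>2 * ?d i) = weighted_energy H ?h n \<tau> / 4"
    unfolding weighted_energy_def sum_divide_distrib
    by (intro sum.cong) (auto simp: e_def power2_eq_square)
  \<comment> \<open>With \<open>W\<close> the energy, nonnegativity reads: 0 is at most the squared
    norm minus \<open>W\<close> plus \<open>W / 2\<close>.\<close>
  ultimately show ?thesis
    by linarith
qed

text \<open>The energies of the approximating combinations are bounded uniformly over partitions,
  and for a fixed partition the energy involves finitely many values, so the bound survives the
  pointwise limit.\<close>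

lemma cm_regular_rkhs:
  assumes "h \<in> rkhs {0..T} (fbm_cov H)"
  shows "cm_regular T H h"
proof -
  obtain c where c: "\<And>n. c n \<in> kernel_coeffs {0..T}"
    and cauchy: "\<And>\<epsilon>. 0 < \<epsilon> \<Longrightarrow> \<exists>N. \<forall>m\<ge>N. \<forall>n\<ge>N. kernel_sqnorm (fbm_cov H) (\<lambda>a. c m a - c n a) < \<epsilon>"
    and lim: "\<And>t. t \<in> {0..T} \<Longrightarrow> (\<lambda>n. kernel_comb (fbm_cov H) (c n) t) \<longlonglongrightarrow> h t"
    using assms unfolding rkhs_def by blast
  let ?k = "\<lambda>n. kernel_comb (fbm_cov H) (c n)"
  obtain M where M: "\<And>n. n \<ge> M \<Longrightarrow> kernel_sqnorm (fbm_cov H) (\<lambda>a. c n a - c M a) < 1"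
    using cauchy[of 1] by auto
  \<comment> \<open>Each approximant is \<open>?k M\<close> plus a difference of squared norm below
    1; squaring the sum costs a factor 2, and \<open>weighted_energy_kernel_comb\<close> another
    one.\<close>
  define B where "B = 4 + 4 * kernel_sqnorm (fbm_cov H) (c M)"
  show ?thesis
  proof (rule cm_regularI)
    fix s t n \<tau>
    assume \<tau>: "interval_partition s t n \<tau>" and st: "0 \<le> s" "t \<le> T"
    have "weighted_energy H (?k m) n \<tau> \<le> B" if "m \<ge> M" for m
    proof -
      let ?g = "kernel_comb (fbm_cov H) (\<lambda>a. c m a - c M a)"
      have "weighted_energy H (?k m) n \<tau> \<le> 2 * weighted_energy H ?g n \<tau> + 2 * weighted_energy H (?k M) n \<tau>"
        unfolding weighted_energy_def sum_distrib_left sum.distrib[symmetric]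
      proof (intro sum_mono)
        fix i
        have "incr (?k m) (\<tau> i) (\<tau> (Suc i)) = incr ?g (\<tau> i) (\<tau> (Suc i)) + incr (?k M) (\<tau> i) (\<tau> (Suc i))"
          unfolding incr_def kernel_comb_diff(2)[OF c c] by simp
        moreover have "(x + y)\<^sup>2 \<le> 2 * x\<^sup>2 + 2 * y\<^sup>2" for x y :: real
          using sum_squares_bound[of x y] by (simp add: power2_sum)
        ultimately have "(incr (?k m) (\<tau> i) (\<tau> (Suc i)))\<^sup>2
            \<le> 2 * (incr ?g (\<tau> i) (\<tau> (Suc i)))\<^sup>2 + 2 * (incr (?k M) (\<tau> i) (\<tau> (Suc i)))\<^sup>2"
          by metis
        from divide_right_mono[OF this, of "(\<tau> (Suc i) - \<tau> i) powr (2 * H)"]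
        show "(incr (?k m) (\<tau> i) (\<tau> (Suc i)))\<^sup>2 / (\<tau> (Suc i) - \<tau> i) powr (2 * H)
            \<le> 2 * ((incr ?g (\<tau> i) (\<tau> (Suc i)))\<^sup>2 / (\<tau> (Suc i) - \<tau> i) powr (2 * H))
              + 2 * ((incr (?k M) (\<tau> i) (\<tau> (Suc i)))\<^sup>2 / (\<tau> (Suc i) - \<tau> i) powr (2 * H))"
          by (simp add: add_divide_distrib)
      qed
      also have "\<dots> \<le> B"
        using weighted_energy_kernel_comb[OF kernel_comb_diff(1)[OF c c] \<tau> st, of m M]
          weighted_energy_kernel_comb[OF c \<tau> st, of M] M[OF that]
        by (simp add: B_def)
      finally show ?thesis .
    qed
    moreover have "(\<lambda>m. weighted_energy H (?k m) n \<tau>) \<longlonglongrightarrow> weighted_energy H h n \<tau>"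
      unfolding weighted_energy_def incr_def
    proof (intro tendsto_sum)
      fix i
      assume "i \<in> {..<n}"
      then have in_T: "\<tau> i \<in> {0..T}" "\<tau> (Suc i) \<in> {0..T}"
        using interval_partition_bounds[OF \<tau>, of i] interval_partition_bounds[OF \<tau>, of "Suc i"] st by auto
      have "(\<lambda>m. (?k m (\<tau> (Suc i)) - ?k m (\<tau> i))\<^sup>2) \<longlonglongrightarrow> (h (\<tau> (Suc i)) - h (\<tau> i))\<^sup>2"
        by (intro tendsto_power tendsto_diff lim in_T)
      from tendsto_mult_right[OF this, of "inverse ((\<tau> (Suc i) - \<tau> i) powr (2 * H))"]
      show "(\<lambda>m. (?k m (\<tau> (Suc i)) - ?k m (\<tau> i))\<^sup>2 / (\<tau> (Suc i) - \<tau> i) powr (2 * H))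
          \<longlonglongrightarrow> (h (\<tau> (Suc i)) - h (\<tau> i))\<^sup>2 / (\<tau> (Suc i) - \<tau> i) powr (2 * H)"
        by (simp add: divide_inverse)
    qed
    ultimately show "weighted_energy H h n \<tau> \<le> B"
      by (intro LIMSEQ_le_const2) auto
  qed
qed

end

subsection \<open>Assembling the translated rough path\<close>

text \<open>Joint continuity of \<open>X\<close> follows from the other data: Chen's relation
  started at 0 expresses \<open>X s t\<close> through \<open>X 0 s\<close>, \<open>X 0 t\<close> and
  \<open>y\<close>, and \<open>X 0\<close> is \<open>\<alpha>\<close>-Hoelder.\<close>

lemma rough_pathsI:
  fixes y :: "real \<Rightarrow> real ^ 'n"
  assumes "0 < \<alpha>" and y: "hoelder T \<alpha> y"
    and chen: "\<And>s r t. 0 \<le> s \<Longrightarrow> s \<le> r \<Longrightarrow> r \<le> t \<Longrightarrow> t \<le> T \<Longrightarrow>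
      X s t = X s r + X r t + incr y s r \<otimes>\<^sub>v incr y r t"
    and X: "\<And>s t. 0 \<le> s \<Longrightarrow> s \<le> t \<Longrightarrow> t \<le> T \<Longrightarrow> norm (X s t) \<le> C * (t - s) powr (2 * \<alpha>)"
  shows "(incr y, X) \<in> rough_paths T \<alpha>"
proof -
  obtain D where D: "0 \<le> D" "\<And>s t. 0 \<le> s \<Longrightarrow> s \<le> t \<Longrightarrow> t \<le> T \<Longrightarrow> norm (incr y s t) \<le> D * (t - s) powr \<alpha>"
    using y unfolding hoelder_def by blast
  let ?\<Delta> = "{(s, t). 0 \<le> s \<and> s \<le> t \<and> t \<le> T}"
  have y_cont: "continuous_on {0..T} y"
    by (rule hoelder_continuous_on[OF y \<open>0 < \<alpha>\<close>])
  \<comment> \<open>The summands bound \<open>X s t\<close> and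
    \<open>incr y 0 s \<otimes>\<^sub>v incr y s t\<close>; the absolute value is there because
    \<open>C\<close> carries no sign condition.\<close>
  define L where "L = \<bar>C\<bar> * T powr \<alpha> + D * T powr \<alpha> * D"
  have "norm (incr (X 0) s t) \<le> L * (t - s) powr \<alpha>" if st: "0 \<le> s" "s \<le> t" "t \<le> T" for s t
  proof -
    have "norm (X s t) \<le> \<bar>C\<bar> * (t - s) powr (2 * \<alpha>)"
      by (rule order_trans[OF X[OF st]]) (simp add: mult_right_mono)
    also have "\<dots> \<le> \<bar>C\<bar> * (T powr \<alpha> * (t - s) powr \<alpha>)"
      using powr_le_powr_smaller[of "t - s" T \<alpha> "2 * \<alpha>"] st \<open>0 < \<alpha>\<close> by (intro mult_left_mono) auto
    finally have 1: "norm (X s t) \<le> \<bar>C\<bar> * (T powr \<alpha> * (t - s) powr \<alpha>)" .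
    have "norm (incr y 0 s) \<le> D * (s - 0) powr \<alpha>"
      using D(2)[of 0 s] st by simp
    also have "\<dots> \<le> D * T powr \<alpha>"
      using st D(1) \<open>0 < \<alpha>\<close> by (intro mult_left_mono powr_mono2) auto
    finally have 2: "norm (incr y 0 s \<otimes>\<^sub>v incr y s t) \<le> (D * T powr \<alpha>) * (D * (t - s) powr \<alpha>)"
      unfolding norm_tensor using D(1) D(2)[OF st] by (intro mult_mono) auto
    have "incr (X 0) s t = X s t + incr y 0 s \<otimes>\<^sub>v incr y s t"
      using chen[of 0 s t] st by (simp add: incr_def[of "X 0"])
    then have "norm (incr (X 0) s t)
        \<le> \<bar>C\<bar> * (T powr \<alpha> * (t - s) powr \<alpha>) + (D * T powr \<alpha>) * (D * (t - s) powr \<alpha>)"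
      using norm_triangle_mono[OF 1 2] by simp
    then show ?thesis
      by (simp add: L_def algebra_simps)
  qed
  then have "hoelder T \<alpha> (X 0)"
    unfolding hoelder_def using D(1) by (intro exI[of _ L]) (auto simp: L_def)
  then have X0_cont: "continuous_on {0..T} (X 0)"
    using \<open>0 < \<alpha>\<close> by (rule hoelder_continuous_on)
  have fst_cont: "continuous_on ?\<Delta> (\<lambda>p. f (fst p))" and snd_cont: "continuous_on ?\<Delta> (\<lambda>p. f (snd p))"
    if "continuous_on {0..T} f" for f :: "real \<Rightarrow> 'v :: real_normed_vector"
    by (rule continuous_on_compose2[OF that]; fastforce intro: continuous_intros)+
  have incr_cont: "continuous_on ?\<Delta> (\<lambda>p. incr y (fst p) (snd p))"
    unfolding incr_def by (intro continuous_on_diff fst_cont snd_cont y_cont)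
  have "continuous_on ?\<Delta> (\<lambda>p. X 0 (snd p) - X 0 (fst p) - incr y 0 (fst p) \<otimes>\<^sub>v incr y (fst p) (snd p))"
    unfolding tensor_def
    by (intro continuous_on_diff continuous_on_vec_lambda continuous_on_mult continuous_on_component
        incr_cont fst_cont snd_cont X0_cont) (simp add: incr_def, intro continuous_intros fst_cont y_cont)
  moreover have "X 0 (snd p) - X 0 (fst p) - incr y 0 (fst p) \<otimes>\<^sub>v incr y (fst p) (snd p) = X (fst p) (snd p)"
    if "p \<in> ?\<Delta>" for p
    using chen[of 0 "fst p" "snd p"] that by auto
  ultimately have "continuous_on ?\<Delta> (\<lambda>p. X (fst p) (snd p))"
    by (rule continuous_on_eq)
  then have "continuous_on ?\<Delta> (\<lambda>(s, t). (incr y s t, X s t))"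
    using incr_cont unfolding split_beta by (intro continuous_on_Pair)
  moreover have "bdd_above {norm (incr y s t) / (t - s) powr \<alpha> | s t. 0 \<le> s \<and> s < t \<and> t \<le> T}"
    using D(2) by (intro bdd_aboveI[of _ D]) (auto simp: divide_le_eq)
  moreover have "bdd_above {norm (X s t) / (t - s) powr (2 * \<alpha>) | s t. 0 \<le> s \<and> s < t \<and> t \<le> T}"
    using X by (intro bdd_aboveI[of _ C]) (auto simp: divide_le_eq)
  moreover have "\<forall>s r t. 0 \<le> s \<and> s \<le> r \<and> r \<le> t \<and> t \<le> T \<longrightarrow> incr y s t = incr y s r + incr y r t \<and>
      X s t = X s r + X r t + incr y s r \<otimes>\<^sub>v incr y r t"
    using chen by (simp add: incr_def)
  ultimately show ?thesis
    unfolding rough_paths_def by blast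
qed

section \<open>Chen relations and bounds of a given rough path\<close>

lemma hoelder_quotient_bound:
  fixes f :: "real \<Rightarrow> real \<Rightarrow> 'v :: real_normed_vector"
  assumes "bdd_above {norm (f s t) / (t - s) powr a | s t. 0 \<le> s \<and> s < t \<and> t \<le> T}"
    and "\<And>s. 0 \<le> s \<Longrightarrow> s \<le> T \<Longrightarrow> f s s = 0"
  obtains C where "0 \<le> C"
    "\<And>s t. 0 \<le> s \<Longrightarrow> s \<le> t \<Longrightarrow> t \<le> T \<Longrightarrow> norm (f s t) \<le> C * (t - s) powr a"
proof -
  obtain C where C: "\<And>s t. 0 \<le> s \<Longrightarrow> s < t \<Longrightarrow> t \<le> T \<Longrightarrow> norm (f s t) / (t - s) powr a \<le> C"
    using assms(1) unfolding bdd_above_def by blast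
  have "norm (f s t) \<le> \<bar>C\<bar> * (t - s) powr a" if "0 \<le> s" "s \<le> t" "t \<le> T" for s t
  proof (cases "s = t")
    case False
    then have "norm (f s t) \<le> C * (t - s) powr a"
      using C[of s t] that by (simp add: divide_le_eq)
    also have "\<dots> \<le> \<bar>C\<bar> * (t - s) powr a"
      by (simp add: mult_right_mono)
    finally show ?thesis .
  qed (use that assms(2) in simp)
  then show ?thesis
    using that[of "\<bar>C\<bar>"] by simp
qed

lemma rough_paths_chen:
  assumes "X \<in> rough_paths T \<alpha>" "0 \<le> s" "s \<le> r" "r \<le> t" "t \<le> T"
  shows "fst X s t = fst X s r + fst X r t"
    and "snd X s t = snd X s r + snd X r t + fst X s r \<otimes>\<^sub>v fst X r t"
  using assms unfolding rough_paths_def by (cases X; auto)+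

text \<open>Chen's relation at \<open>s = r = t\<close> makes the diagonal values vanish, which
  extends the quotient bounds to \<open>s \<le> t\<close>; the sum of the two constants serves both
  levels.\<close>

lemma rough_paths_bounds:
  assumes "X \<in> rough_paths T \<alpha>"
  obtains C where "0 \<le> C"
    "\<And>s t. 0 \<le> s \<Longrightarrow> s \<le> t \<Longrightarrow> t \<le> T \<Longrightarrow> norm (fst X s t) \<le> C * (t - s) powr \<alpha>"
    "\<And>s t. 0 \<le> s \<Longrightarrow> s \<le> t \<Longrightarrow> t \<le> T \<Longrightarrow> norm (snd X s t) \<le> C * (t - s) powr (2 * \<alpha>)"
proof -
  have bdd: "bdd_above {norm (fst X s t) / (t - s) powr \<alpha> | s t. 0 \<le> s \<and> s < t \<and> t \<le> T}"
    "bdd_above {norm (snd X s t) / (t - s) powr (2 * \<alpha>) | s t. 0 \<le> s \<and> s < t \<and> t \<le> T}"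
    using assms unfolding rough_paths_def by (cases X; simp)+
  have fst0: "fst X s s = 0" if "0 \<le> s" "s \<le> T" for s
    using rough_paths_chen(1)[OF assms, of s s s] that by simp
  have snd0: "snd X s s = 0" if "0 \<le> s" "s \<le> T" for s
    using rough_paths_chen(2)[OF assms, of s s s] that fst0[OF that] by (simp add: tensor_zero_right)
  obtain C where C: "0 \<le> C"
    "\<And>s t. 0 \<le> s \<Longrightarrow> s \<le> t \<Longrightarrow> t \<le> T \<Longrightarrow> norm (fst X s t) \<le> C * (t - s) powr \<alpha>"
    using hoelder_quotient_bound[OF bdd(1) fst0] by blast
  obtain D where D: "0 \<le> D"
    "\<And>s t. 0 \<le> s \<Longrightarrow> s \<le> t \<Longrightarrow> t \<le> T \<Longrightarrow> norm (snd X s t) \<le> D * (t - s) powr (2 * \<alpha>)"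
    using hoelder_quotient_bound[OF bdd(2) snd0] by blast
  show ?thesis
  proof (rule that[of "C + D"])
    fix s t
    assume st: "0 \<le> s" "s \<le> t" "t \<le> T"
    show "norm (fst X s t) \<le> (C + D) * (t - s) powr \<alpha>"
      using C(2)[OF st] D(1) by (simp add: distrib_right add_increasing2)
    show "norm (snd X s t) \<le> (C + D) * (t - s) powr (2 * \<alpha>)"
      using D(2)[OF st] C(1) by (simp add: distrib_right add_increasing)
  qed (use C D in simp)
qed

section \<open>Joined vectors and block matrices\<close>

lemma sum_UNIV_Plus:
  "(\<Sum>k\<in>UNIV. f k) = (\<Sum>i\<in>UNIV. f (Inl i)) + (\<Sum>j\<in>UNIV. f (Inr j))"
  for f :: "'a :: finite + 'b :: finite \<Rightarrow> 'v :: comm_monoid_add"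
  unfolding UNIV_Plus_UNIV[symmetric] by (subst sum.Plus) (auto simp: o_def)

lemma norm_vec_power2: "(norm x)\<^sup>2 = (\<Sum>i\<in>UNIV. (norm (x $ i))\<^sup>2)"
  by (simp add: norm_vec_def L2_set_def sum_nonneg)

lemma norm_join_vec: "(norm (join_vec x y))\<^sup>2 = (norm x)\<^sup>2 + (norm y)\<^sup>2"
  unfolding norm_vec_power2 by (simp add: sum_UNIV_Plus join_vec_def)

lemma norm_join_vec_le: "norm (join_vec x y) \<le> norm x + norm y"
  by (rule power2_le_imp_le) (simp_all add: norm_join_vec power2_sum)

lemma norm_le_norm_join_vec: "norm x \<le> norm (join_vec x y)" "norm y \<le> norm (join_vec x y)"
  by (rule power2_le_imp_le; simp add: norm_join_vec)+

lemma norm_block_matrix_le: "norm (block_matrix A B C D) \<le> norm A + norm B + norm C + norm D"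
proof -
  have "(norm (block_matrix A B C D))\<^sup>2 = ((norm A)\<^sup>2 + (norm B)\<^sup>2) + ((norm C)\<^sup>2 + (norm D)\<^sup>2)"
    unfolding norm_vec_power2 by (simp add: sum_UNIV_Plus block_matrix_def sum.distrib)
  also have "\<dots> \<le> (norm A + norm B + norm C + norm D)\<^sup>2"
    by (simp add: power2_eq_square algebra_simps)
  finally show ?thesis
    by (rule power2_le_imp_le) simp
qed

lemma block_matrix_add:
  "block_matrix A B C D + block_matrix A' B' C' D' = block_matrix (A + A') (B + B') (C + C') (D + D')"
  by (simp add: block_matrix_def vec_eq_iff split: sum.split)

lemma tensor_join_vec:
  "join_vec a b \<otimes>\<^sub>v join_vec c d = block_matrix (a \<otimes>\<^sub>v c) (a \<otimes>\<^sub>v d) (b \<otimes>\<^sub>v c) (b \<otimes>\<^sub>v d)"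
  by (simp add: tensor_def join_vec_def block_matrix_def vec_eq_iff split: sum.split)

lemma incr_join_vec: "incr (\<lambda>t. join_vec (x t) (y t)) s t = join_vec (incr x s t) (incr y s t)"
  by (simp add: incr_def join_vec_def vec_eq_iff split: sum.split)

lemma incr_add: "incr (\<lambda>t. x t + y t) s t = incr x s t + incr y s t"
  by (simp add: incr_def)

lemma hoelder_add:
  assumes "hoelder T \<alpha> x" "hoelder T \<alpha> y"
  shows "hoelder T \<alpha> (\<lambda>t. x t + y t)"
proof -
  obtain C where C: "0 \<le> C" "\<And>s t. 0 \<le> s \<Longrightarrow> s \<le> t \<Longrightarrow> t \<le> T \<Longrightarrow> norm (incr x s t) \<le> C * (t - s) powr \<alpha>"
    using assms(1) unfolding hoelder_def by blast
  obtain D where D: "0 \<le> D" "\<And>s t. 0 \<le> s \<Longrightarrow> s \<le> t \<Longrightarrow> t \<le> T \<Longrightarrow> norm (incr y s t) \<le> D * (t - s) powr \<alpha>"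
    using assms(2) unfolding hoelder_def by blast
  show ?thesis
    unfolding hoelder_def incr_add
    using C(1) D(1) norm_triangle_mono[OF C(2) D(2)]
    by (intro exI[of _ "C + D"]) (auto simp: distrib_right)
qed

lemma hoelder_join_vec:
  assumes "hoelder T \<alpha> x" "hoelder T \<alpha> y"
  shows "hoelder T \<alpha> (\<lambda>t. join_vec (x t) (y t))"
proof -
  obtain C where C: "0 \<le> C" "\<And>s t. 0 \<le> s \<Longrightarrow> s \<le> t \<Longrightarrow> t \<le> T \<Longrightarrow> norm (incr x s t) \<le> C * (t - s) powr \<alpha>"
    using assms(1) unfolding hoelder_def by blast
  obtain D where D: "0 \<le> D" "\<And>s t. 0 \<le> s \<Longrightarrow> s \<le> t \<Longrightarrow> t \<le> T \<Longrightarrow> norm (incr y s t) \<le> D * (t - s) powr \<alpha>"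
    using assms(2) unfolding hoelder_def by blast
  show ?thesis
    unfolding hoelder_def incr_join_vec
    using C(1) D(1) order_trans[OF norm_join_vec_le add_mono[OF C(2) D(2)]]
    by (intro exI[of _ "C + D"]) (auto simp: distrib_right)
qed

lemma young_pair_chen:
  assumes "young_pair T \<alpha> x z" "0 \<le> s" "s \<le> r" "r \<le> t" "t \<le> T"
  shows "young_integral x z s t
    = young_integral x z s r + young_integral x z r t + incr x s r \<otimes>\<^sub>v incr z r t"
  using assms unfolding young_pair_def by blast

text \<open>The pathwise statement: only the first level of \<open>X\<close> is tied to
  \<open>\<beta>\<close> and \<open>\<gamma>\<close>, while the second enters through Chen's
  relation and its size.\<close>

lemma young_translation_rough_path:
  fixes \<beta> u :: "real \<Rightarrow> real ^ 'd" and \<gamma> v :: "real \<Rightarrow> real ^ 'e" and X :: "('d + 'e) rough"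
  assumes exps: "0 < \<alpha>" "\<alpha> \<le> H" "1 / 2 < \<alpha> + H" "H \<le> 1 / 2"
    and X: "X \<in> rough_paths T \<alpha>"
    and fst_X: "\<And>s t. 0 \<le> s \<Longrightarrow> s \<le> t \<Longrightarrow> t \<le> T \<Longrightarrow> fst X s t = join_vec (incr \<beta> s t) (incr \<gamma> s t)"
    and u: "cm_regular T H u" and v: "cm_regular T H v"
  shows "young_translation_defined T \<beta> \<gamma> u v \<and> young_translation \<beta> \<gamma> u v X \<in> rough_paths T \<alpha>"
proof -
  obtain C where C: "0 \<le> C"
    "\<And>s t. 0 \<le> s \<Longrightarrow> s \<le> t \<Longrightarrow> t \<le> T \<Longrightarrow> norm (fst X s t) \<le> C * (t - s) powr \<alpha>"
    "\<And>s t. 0 \<le> s \<Longrightarrow> s \<le> t \<Longrightarrow> t \<le> T \<Longrightarrow> norm (snd X s t) \<le> C * (t - s) powr (2 * \<alpha>)"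
    using rough_paths_bounds[OF X] by blast
  have "norm (incr \<beta> s t) \<le> C * (t - s) powr \<alpha>" "norm (incr \<gamma> s t) \<le> C * (t - s) powr \<alpha>"
    if st: "0 \<le> s" "s \<le> t" "t \<le> T" for s t
    using norm_le_norm_join_vec[where x = "incr \<beta> s t" and y = "incr \<gamma> s t"] C(2)[OF st]
    unfolding fst_X[OF st] by linarith+
  then have \<beta>: "hoelder T \<alpha> \<beta>" and \<gamma>: "hoelder T \<alpha> \<gamma>"
    unfolding hoelder_def using C(1) by blast+
  have hu: "hoelder T \<alpha> u" and hv: "hoelder T \<alpha> v"
    using cm_regular_hoelder[OF u exps(2)] cm_regular_hoelder[OF v exps(2)] .
  note pair = young_pair_hoelder_cm_regular[OF _ _ exps]
  \<comment> \<open>In the order of the matrix entries. For integrals between \<open>u\<close> and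
    \<open>v\<close>, one of the paths takes the Hoelder role.\<close>
  note pairs = pair(1)[OF \<beta> u] pair(2)[OF \<beta> u] pair(1)[OF hu u]
    pair(1)[OF \<beta> v] pair(2)[OF \<gamma> u] pair(1)[OF hu v]
    pair(1)[OF \<gamma> u] pair(2)[OF \<beta> v] pair(1)[OF hv u]
    pair(1)[OF \<gamma> v] pair(2)[OF \<gamma> v] pair(1)[OF hv v]
  have defined: "young_translation_defined T \<beta> \<gamma> u v"
    using pairs unfolding young_translation_defined_def young_pair_def by blast
  let ?y = "\<lambda>t. join_vec (\<beta> t + u t) (\<gamma> t + v t)"
  let ?I = young_integral
  define J where "J s t = block_matrix
      (?I \<beta> u s t + ?I u \<beta> s t + ?I u u s t) (?I \<beta> v s t + ?I u \<gamma> s t + ?I u v s t)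
      (?I \<gamma> u s t + ?I v \<beta> s t + ?I v u s t) (?I \<gamma> v s t + ?I v \<gamma> s t + ?I v v s t)" for s t
  \<comment> \<open>Closure of this predicate under sums spares explicit constants for the twelve
    integrals.\<close>
  define bounded :: "(real \<Rightarrow> real \<Rightarrow> real) \<Rightarrow> bool"
    where "bounded f \<longleftrightarrow> (\<exists>C. \<forall>s t. 0 \<le> s \<and> s \<le> t \<and> t \<le> T \<longrightarrow> f s t \<le> C * (t - s) powr (2 * \<alpha>))" for f
  have bounded_add: "bounded (\<lambda>s t. f s t + g s t)" if f: "bounded f" and g: "bounded g" for f g
  proof -
    obtain C where "\<forall>s t. 0 \<le> s \<and> s \<le> t \<and> t \<le> T \<longrightarrow> f s t \<le> C * (t - s) powr (2 * \<alpha>)"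
      using f unfolding bounded_def by blast
    moreover obtain D where "\<forall>s t. 0 \<le> s \<and> s \<le> t \<and> t \<le> T \<longrightarrow> g s t \<le> D * (t - s) powr (2 * \<alpha>)"
      using g unfolding bounded_def by blast
    ultimately show ?thesis
      unfolding bounded_def by (intro exI[of _ "C + D"]) (auto simp: distrib_right intro!: add_mono)
  qed
  have bounded_le: "bounded f" if "bounded g" "\<And>s t. f s t \<le> g s t" for f g
    using that unfolding bounded_def by (meson order_trans)
  have bounded_norm_add: "bounded (\<lambda>s t. norm (f s t + g s t))"
    if "bounded (\<lambda>s t. norm (f s t))" "bounded (\<lambda>s t. norm (g s t))"
    for f g :: "real \<Rightarrow> real \<Rightarrow> 'v :: real_normed_vector"
    using bounded_add[OF that] norm_triangle_ineq by (rule bounded_le)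
  have bounded_pair: "bounded (\<lambda>s t. norm (?I x z s t))" if "young_pair T \<alpha> x z"
    for x :: "real \<Rightarrow> real ^ 'm" and z :: "real \<Rightarrow> real ^ 'n"
    using that unfolding bounded_def young_pair_def by blast
  have "bounded (\<lambda>s t. norm (J s t))"
    unfolding J_def
    by (rule bounded_le[OF _ norm_block_matrix_le])
      (intro bounded_add bounded_norm_add bounded_pair pairs)
  moreover have "bounded (\<lambda>s t. norm (snd X s t))"
    using C(3) unfolding bounded_def by blast
  ultimately obtain D where D: "\<And>s t. 0 \<le> s \<Longrightarrow> s \<le> t \<Longrightarrow> t \<le> T \<Longrightarrow>
      norm (snd X s t + J s t) \<le> D * (t - s) powr (2 * \<alpha>)"
    using bounded_norm_add[of "snd X" J] unfolding bounded_def by blast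
  have "(incr ?y, \<lambda>s t. snd X s t + J s t) \<in> rough_paths T \<alpha>"
  proof (rule rough_pathsI[OF exps(1) hoelder_join_vec[OF hoelder_add[OF \<beta> hu] hoelder_add[OF \<gamma> hv]] _ D])
    fix s r t
    assume st: "0 \<le> s" "s \<le> r" "r \<le> t" "t \<le> T"
    have 1: "snd X s t = snd X s r + snd X r t + block_matrix
        (incr \<beta> s r \<otimes>\<^sub>v incr \<beta> r t) (incr \<beta> s r \<otimes>\<^sub>v incr \<gamma> r t)
        (incr \<gamma> s r \<otimes>\<^sub>v incr \<beta> r t) (incr \<gamma> s r \<otimes>\<^sub>v incr \<gamma> r t)"
      using rough_paths_chen(2)[OF X st] fst_X st by (simp add: tensor_join_vec)
    have 2: "incr ?y s r \<otimes>\<^sub>v incr ?y r t = block_matrix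
        ((incr \<beta> s r + incr u s r) \<otimes>\<^sub>v (incr \<beta> r t + incr u r t))
        ((incr \<beta> s r + incr u s r) \<otimes>\<^sub>v (incr \<gamma> r t + incr v r t))
        ((incr \<gamma> s r + incr v s r) \<otimes>\<^sub>v (incr \<beta> r t + incr u r t))
        ((incr \<gamma> s r + incr v s r) \<otimes>\<^sub>v (incr \<gamma> r t + incr v r t))"
      by (simp only: incr_join_vec incr_add tensor_join_vec)
    \<comment> \<open>In each block the Chen terms of the three integrals and the tensor coming from
      \<open>X\<close> are the four terms of the expanded product of translated increments.\<close>
    have 3: "J s t + block_matrix
        (incr \<beta> s r \<otimes>\<^sub>v incr \<beta> r t) (incr \<beta> s r \<otimes>\<^sub>v incr \<gamma> r t)
        (incr \<gamma> s r \<otimes>\<^sub>v incr \<beta> r t) (incr \<gamma> s r \<otimes>\<^sub>v incr \<gamma> r t)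
        = J s r + J r t + incr ?y s r \<otimes>\<^sub>v incr ?y r t"
      unfolding 2 J_def block_matrix_add pairs[THEN young_pair_chen, OF st] tensor_add_left tensor_add_right
      by (intro arg_cong4[of _ _ _ _ _ _ _ _ block_matrix]) (simp_all add: ac_simps)
    have "snd X s t + J s t = snd X s r + snd X r t + (J s t + block_matrix
        (incr \<beta> s r \<otimes>\<^sub>v incr \<beta> r t) (incr \<beta> s r \<otimes>\<^sub>v incr \<gamma> r t)
        (incr \<gamma> s r \<otimes>\<^sub>v incr \<beta> r t) (incr \<gamma> s r \<otimes>\<^sub>v incr \<gamma> r t))"
      by (simp add: 1 ac_simps)
    then show "snd X s t + J s t
        = snd X s r + J s r + (snd X r t + J r t) + incr ?y s r \<otimes>\<^sub>v incr ?y r t"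
      unfolding 3 by (simp add: ac_simps)
  qed
  then have "young_translation \<beta> \<gamma> u v X \<in> rough_paths T \<alpha>"
    unfolding young_translation_def J_def .
  with defined show ?thesis
    by blast
qed

section \<open>Feature maps for the Brownian and the fractional covariance\<close>

lemma fbm_feature_indicator: "fbm_feature T (1 / 2) lborel (\<lambda>t. indicator {0..t})"
proof
  fix s t
  assume st: "s \<in> {0..T}" "t \<in> {0..T}"
  \<comment> \<open>The \<open>L2\<close> inner product of the two indicators is the length of
    \<open>[0, min s t]\<close>, the Brownian covariance. This deterministic family avoids deriving
    the covariance from the increments in \<open>bm_real\<close>.\<close>
  have "indicator {0..s} x * indicator {0..t} x = (indicator {0..min s t} x :: real)" for x :: real
    by (simp add: indicator_def)
  moreover have "fbm_cov (1 / 2) s t = measure lborel {0..min s t}"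
    using st by (auto simp: fbm_cov_def min_def abs_if)
  moreover have "has_bochner_integral lborel (indicator {0..min s t} :: real \<Rightarrow> real) (measure lborel {0..min s t})"
    using st by (intro has_bochner_integral_real_indicator) auto
  ultimately show "has_bochner_integral lborel (\<lambda>x. indicator {0..s} x * indicator {0..t} x) (fbm_cov (1 / 2) s t)"
    by (simp only:)
qed auto

text \<open>A Bochner integral of a nonintegrable function is 0, so the nonzero variances already give
  square integrability; at time 0 the variance is 0 and the value is set to 0.\<close>

lemma fbm_feature_process:
  assumes "fbm_real M T H X" "0 < H" "H \<le> 1 / 2"
  shows "fbm_feature T H M (\<lambda>t. if t = 0 then (\<lambda>_. 0) else X t)"
proof
  fix s t
  assume st: "s \<in> {0..T}" "t \<in> {0..T}"
  let ?\<phi> = "\<lambda>t. if t = 0 then (\<lambda>_. 0) else X t"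
  have gp: "gaussian_process M {0..T} X"
    and cov: "\<And>s t. s \<in> {0..T} \<Longrightarrow> t \<in> {0..T} \<Longrightarrow> (\<integral>\<omega>. X s \<omega> * X t \<omega> \<partial>M) = fbm_cov H s t"
    using assms(1) by (auto simp: fbm_real_def)
  have meas: "X r \<in> borel_measurable M" if "r \<in> {0..T}" for r
    using gp[unfolded gaussian_process_def, rule_format, of "{r}" "\<lambda>_. 1"] that
    by (auto simp: normal_rv_def)
  have square: "integrable M (\<lambda>\<omega>. X r \<omega> * X r \<omega>)" if "r \<in> {0..T}" "r \<noteq> 0" for r
    using cov[OF that(1,1)] that(2) not_integrable_integral_eq[of M "\<lambda>\<omega>. X r \<omega> * X r \<omega>"]
    by (auto simp: fbm_cov_def)
  show "has_bochner_integral M (\<lambda>\<omega>. ?\<phi> s \<omega> * ?\<phi> t \<omega>) (fbm_cov H s t)"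
  proof (cases "s = 0 \<or> t = 0")
    case True
    then show ?thesis
      using st by (auto simp: fbm_cov_def)
  next
    case False
    \<comment> \<open>The product is dominated by the sum of the squares, which are integrable as
      both times are nonzero.\<close>
    have "integrable M (\<lambda>\<omega>. X s \<omega> * X t \<omega>)"
    proof (rule Bochner_Integration.integrable_bound)
      show "integrable M (\<lambda>\<omega>. X s \<omega> * X s \<omega> + X t \<omega> * X t \<omega>)"
        using False st by (intro Bochner_Integration.integrable_add square) auto
      show "(\<lambda>\<omega>. X s \<omega> * X t \<omega>) \<in> borel_measurable M"
        using meas st by (intro borel_measurable_times) auto
      have "\<bar>x * y\<bar> \<le> x * x + y * y" for x y :: real
        using sum_squares_bound[of "\<bar>x\<bar>" "\<bar>y\<bar>"] abs_ge_zero[of "x * y"]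
        unfolding abs_mult power2_eq_square mult.assoc abs_mult_self_eq by linarith
      then show "AE \<omega> in M. norm (X s \<omega> * X t \<omega>) \<le> norm (X s \<omega> * X s \<omega> + X t \<omega> * X t \<omega>)"
        by (simp add: abs_of_nonneg)
    qed
    then show ?thesis
      using False cov[OF st] by (simp add: has_bochner_integral_iff)
  qed
qed (use assms in auto)

section \<open>The almost sure translation of the mixed lift\<close>

theorem mainTheorem2:
  fixes M :: "'a measure"
    and T H \<alpha> :: real
    and b :: "real \<Rightarrow> 'a \<Rightarrow> real ^ 'd"
    and w :: "real \<Rightarrow> 'a \<Rightarrow> real ^ 'e"
    and \<Lambda> :: "'a \<Rightarrow> ('d + 'e) rough"
    and u :: "real \<Rightarrow> real ^ 'd"
    and v :: "real \<Rightarrow> real ^ 'e"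
  assumes "prob_space M"
    and "0 < T"
    and "1 / 3 < H" and "H < 1 / 2"
    and "1 / 3 < \<alpha>" and "\<alpha> < H"
    and "fractional_brownian_motion M T H b"
    and "standard_brownian_motion M T w"
    and "independent_processes M T b w"
    and "mixed_fbm_lift M T \<alpha> b w \<Lambda>"
    and "AE \<omega> in M. \<Lambda> \<omega> \<in> rough_paths T \<alpha>"
    and "(u, v) \<in> cameron_martin T H \<times> cameron_martin T (1 / 2)"
  shows "AE \<omega> in M.
    young_translation_defined T (\<lambda>t. b t \<omega>) (\<lambda>t. w t \<omega>) u v \<and>
    young_translation (\<lambda>t. b t \<omega>) (\<lambda>t. w t \<omega>) u v (\<Lambda> \<omega>) \<in> rough_paths T \<alpha>"
proof -
  have u: "cm_regular T H u"
  proof (rule cm_regular_vec)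
    fix i
    have fbm: "fbm_real M T H (\<lambda>t \<omega>. b t \<omega> $ i)"
      using assms(7) by (simp add: fractional_brownian_motion_def)
    have "0 < H" "H \<le> 1 / 2"
      using assms(3,4) by simp_all
    \<comment> \<open>The component of the process serves as the feature map of its own
      covariance.\<close>
    note feature = fbm_feature_process[OF fbm this]
    have "(\<lambda>t. u t $ i) \<in> rkhs {0..T} (fbm_cov H)"
      using assms(12) by (simp add: cameron_martin_def)
    then show "cm_regular T H (\<lambda>t. u t $ i)"
      by (rule fbm_feature.cm_regular_rkhs[OF feature])
  qed
  have "cm_regular T (1 / 2) v"
  proof (rule cm_regular_vec)
    fix j
    have "(\<lambda>t. v t $ j) \<in> rkhs {0..T} (fbm_cov (1 / 2))"
      using assms(12) by (simp add: cameron_martin_def)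
    then show "cm_regular T (1 / 2) (\<lambda>t. v t $ j)"
      by (rule fbm_feature.cm_regular_rkhs[OF fbm_feature_indicator])
  qed
  from cm_regular_mono[OF this] have v: "cm_regular T H v"
    using assms(4) by simp
  have fst_\<Lambda>: "fst (\<Lambda> \<omega>) s t = join_vec (incr (\<lambda>r. b r \<omega>) s t) (incr (\<lambda>r. w r \<omega>) s t)"
    if "\<omega> \<in> space M" "0 \<le> s" "s \<le> t" "t \<le> T" for \<omega> s t
    using assms(10) that unfolding mixed_fbm_lift_def by (elim exE conjE) simp
  show ?thesis
    \<comment> \<open>The exceptional set is the one where \<open>\<Lambda> \<omega>\<close> fails
      to be a rough path; the first level is given on all of \<open>space M\<close>.\<close>
    using assms(11) AE_space
  proof eventually_elim
    case (elim \<omega>)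
    \<comment> \<open>The Young condition \<open>1 / 2 < \<alpha> + H\<close> holds because both
      exponents exceed 1/3.\<close>
    have "0 < \<alpha>" "\<alpha> \<le> H" "1 / 2 < \<alpha> + H" "H \<le> 1 / 2"
      using assms(3-6) by linarith+
    then show ?case
      using elim(1) fst_\<Lambda>[OF elim(2)] u v by (rule young_translation_rough_path)
  qed
qed

end
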